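(* For each $\varepsilon>0$, with probability 1 there exists $n_0=n_0(\varepsilon)$ such that for all $n\ge n_0$: (i) $(\xi(S_j,\infty),\Xi(S_j,\infty))\in((1+\varepsilon)\log n)\,\mathcal D$ for all $j=1,2,\dots,n$; (ii) for every $(k,\ell)\in((1-\varepsilon)\log n)\,\mathcal D\cap\mathbb Z^2$ there exists a (random) integer $j=j(k,\ell)\le n$ with $(\xi(S_j,\infty),\Xi(S_j,\infty))=(k+1,\ell+2)$.
   Context: Let $0<q<p<1$ with $p+q=1$. Let $X_1,X_2,\dots$ be i.i.d. with $\mathbf P(X_1=1)=p$, $\mathbf P(X_1=-1)=q$, $S_0=0$, $S_n=X_1+\dots+X_n$. For $z\in\mathbb Z$ let $\xi(z,\infty)=\#\{k\ge1:S_k=z\}$ (finite a.s.) and $\Xi(z,\infty)=\xi(z-1,\infty)+\xi(z+1,\infty)$. Define, with the convention $0\log0=0$, $$g(x,y)=x\log x-y\log y+(y-x)\log(y-x)-x\log(2p)-y\log q,$$ and $\mathcal D=\{(x,y)\in\mathbb R^2: y\ge x\ge0,\ g(x,y)\le1\}$. For $c>0$, $c\mathcal D=\{(cx,cy):(x,y)\in\mathcal D\}$.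
   Formalization: The formal statement takes 0<ε<1: for ε≥1 the set ((1−ε)log n)𝒟 in (ii) is not defined (c𝒟 is defined only for c>0); part (i) for ε≥1 follows from smaller ε since c𝒟 increases with c. *)

theory Defs
  imports "HOL-Probability.Probability"
begin

definition xlogx :: "real \<Rightarrow> real" where
  "xlogx t = (if t = 0 then 0 else t * ln t)"

definition gfun :: "real \<Rightarrow> real \<Rightarrow> real \<Rightarrow> real \<Rightarrow> real" where
  "gfun p q x y = xlogx x - xlogx y + xlogx (y - x) - x * ln (2 * p) - y * ln q"

definition Dset :: "real \<Rightarrow> real \<Rightarrow> (real \<times> real) set" where
  "Dset p q = {(x, y). y \<ge> x \<and> x \<ge> 0 \<and> gfun p q x y \<le> 1}"

definition scaleD :: "real \<Rightarrow> (real \<times> real) set \<Rightarrow> (real \<times> real) set" where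
  "scaleD c A = {(c * x, c * y) | x y. (x, y) \<in> A}"

definition walk :: "(nat \<Rightarrow> 'a \<Rightarrow> int) \<Rightarrow> nat \<Rightarrow> 'a \<Rightarrow> int" where
  "walk X n \<omega> = (\<Sum>i\<in>{1..n}. X i \<omega>)"

definition loc_time :: "(nat \<Rightarrow> 'a \<Rightarrow> int) \<Rightarrow> int \<Rightarrow> 'a \<Rightarrow> nat" where
  "loc_time X z \<omega> = card {k. k \<ge> 1 \<and> walk X k \<omega> = z}"

definition nb_loc_time :: "(nat \<Rightarrow> 'a \<Rightarrow> int) \<Rightarrow> int \<Rightarrow> 'a \<Rightarrow> nat" where
  "nb_loc_time X z \<omega> = loc_time X (z - 1) \<omega> + loc_time X (z + 1) \<omega>"

end

(* A visit to a neighbour of a site is followed, with probability q, by a return to it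
   before any visit to the site, whatever the side. Hence the pair of local times
   of a site has, up to constants, the law C(l,k) (2p)^k q^l, which is exp (- g(k,l)) up to
   polynomial factors; summing over sites (Borel-Cantelli) gives (i). For (ii), a walk that never
   strays far below its running maximum, nor ever returns to a level after logarithmic time, lets
   the local times of suitable sites be read off from disjoint time blocks of logarithmic length.
   These are independent, there are n^(1-o(1)) of them, and each succeeds with probability at
   least n^(-(1-epsilon)-o(1)). *)
theory Submission
  imports Defs "HOL-Real_Asymp.Real_Asymp"
begin

section \<open>Path sums and the first step equations\<close>

text \<open>The counts run over infinite time, while independence gives direct access only to
  finitely many steps. The infinite-time law therefore never appears as a measure: \<open>H\<close>
  is an explicit solution of the first step equations, and only its distance from the law truncated
  at time \<open>N\<close> is estimated. One exponential weight makes this distance, the drift and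
  the transience quantitative: s = \<open>lam\<close> minimises p*s + q/s, and the minimum
  \<open>gam\<close> is below 1 because p differs from q. For a walk starting at distance d below a
  site, truncation costs a constant times \<open>lam\<close> to the power -d times
  \<open>gam ^ N\<close>, so that a window of order log n suffices when d is of order log n. The
  shift (k+1, l+2) in (ii) is forced by geometry: a walk coming from far below reaches the site
  through its lower neighbour and finally leaves through the upper one, so k+1 visits to the site
  come with at least k+2 visits to the neighbours.\<close>

locale drift =
  fixes p q :: real
  assumes q_pos: "0 < q" and q_less_p: "q < p" and p_plus_q: "p + q = 1"
begin

lemma p_pos: "0 < p" and p_less_1: "p < 1" and q_less_1: "q < 1" and q_less_half: "q < 1/2"
  using q_pos q_less_p p_plus_q by linarith+

lemma p_eq: "p = 1 - q"
  using p_plus_q by linarith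

section \<open>Expectations over finite step sequences\<close>

definition paths :: "nat \<Rightarrow> int list set" where
  "paths N = {xs. set xs \<subseteq> {1, -1} \<and> length xs = N}"

definition wt :: "int list \<Rightarrow> real" where
  "wt xs = (\<Prod>d\<leftarrow>xs. if d = 1 then p else q)"

definition avg :: "nat \<Rightarrow> (int list \<Rightarrow> real) \<Rightarrow> real" where
  "avg N f = (\<Sum>xs\<in>paths N. wt xs * f xs)"

lemma finite_paths [simp]: "finite (paths N)"
  unfolding paths_def by (rule finite_lists_length_eq) simp

lemma paths_0 [simp]: "paths 0 = {[]}"
  by (auto simp: paths_def)

lemma paths_Suc: "paths (Suc N) = (#) 1 ` paths N \<union> (#) (-1) ` paths N"
  by (auto simp: paths_def length_Suc_conv)

lemma wt_Nil [simp]: "wt [] = 1"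
  and wt_Cons: "wt (d # xs) = (if d = 1 then p else q) * wt xs"
  by (simp_all add: wt_def)

lemma wt_nonneg: "0 \<le> wt xs"
  using p_pos q_pos by (induction xs) (auto simp: wt_Cons)

lemma avg_0 [simp]: "avg 0 f = f []"
  by (simp add: avg_def)

lemma avg_Suc: "avg (Suc N) f = p * avg N (\<lambda>xs. f (1 # xs)) + q * avg N (\<lambda>xs. f (-1 # xs))"
proof -
  have "avg (Suc N) f = (\<Sum>xs\<in>(#) 1 ` paths N. wt xs * f xs) + (\<Sum>xs\<in>(#) (-1) ` paths N. wt xs * f xs)"
    unfolding avg_def paths_Suc by (rule sum.union_disjoint) auto
  then show ?thesis
    by (simp add: sum.reindex wt_Cons avg_def sum_distrib_left mult_ac)
qed

lemma avg_cong: "(\<And>xs. xs \<in> paths N \<Longrightarrow> f xs = g xs) \<Longrightarrow> avg N f = avg N g"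
  by (simp add: avg_def)

lemma avg_mono: "(\<And>xs. xs \<in> paths N \<Longrightarrow> f xs \<le> g xs) \<Longrightarrow> avg N f \<le> avg N g"
  unfolding avg_def by (intro sum_mono mult_left_mono wt_nonneg)

lemma avg_sum: "avg N (\<lambda>xs. \<Sum>i\<in>I. f i xs) = (\<Sum>i\<in>I. avg N (f i))"
  unfolding avg_def by (simp add: sum_distrib_left sum.swap[of _ I])

lemma avg_cmult: "avg N (\<lambda>xs. c * f xs) = c * avg N f"
  unfolding avg_def by (simp add: sum_distrib_left mult_ac)

lemma avg_const [simp]: "avg N (\<lambda>_. c) = c"
proof (induction N)
  case (Suc N)
  have "avg (Suc N) (\<lambda>_. c) = (p + q) * c"
    unfolding avg_Suc Suc by algebra
  then show ?case by (simp add: p_plus_q)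
qed simp

lemma avg_diff: "avg N (\<lambda>xs. f xs - g xs) = avg N f - avg N g"
  unfolding avg_def by (simp add: right_diff_distrib sum_subtractf)

lemma avg_split:
  "avg (N + K) (\<lambda>xs. f (take N xs) * g (drop N xs)) = avg N f * avg K g"
proof (induction N arbitrary: f)
  case 0
  then show ?case by (simp add: avg_cmult)
next
  case (Suc N)
  have "avg (Suc N + K) (\<lambda>xs. f (take (Suc N) xs) * g (drop (Suc N) xs))
      = p * (avg N (\<lambda>xs. f (1 # xs)) * avg K g) + q * (avg N (\<lambda>xs. f (-1 # xs)) * avg K g)"
    unfolding Suc[symmetric] by (simp add: avg_Suc)
  then show ?case by (simp add: avg_Suc algebra_simps)
qed

section \<open>Visit counts in finite time and their first step equations\<close>

primrec visits :: "int set \<Rightarrow> int \<Rightarrow> int list \<Rightarrow> int" where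
  "visits A x [] = 0"
| "visits A x (d # xs) = of_bool (x + d \<in> A) + visits A (x + d) xs"

lemma visits_nonneg: "0 \<le> visits A x xs"
  by (induction xs arbitrary: x) auto

lemma visits_le: "visits A x xs \<le> int (length xs)"
proof (induction xs arbitrary: x)
  case (Cons d xs)
  have "(of_bool (x + d \<in> A) :: int) \<le> 1" by simp
  with Cons[of "x + d"] show ?case unfolding visits.simps by simp
qed simp

text \<open>Counts are integers so that the arguments k - 1 and l - 1 of the first step equation
  make sense without a case distinction at 0. The starting point is not counted, in agreement with
  local times that begin at time 1.\<close>

definition site_law :: "nat \<Rightarrow> int \<Rightarrow> int \<Rightarrow> int \<Rightarrow> real" where
  "site_law N x k l = avg N (\<lambda>xs. of_bool (visits {0} x xs = k \<and> visits {-1, 1} x xs = l))"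

lemma site_law_0: "site_law 0 x k l = of_bool (k = 0 \<and> l = 0)"
  by (auto simp: site_law_def)

lemma site_law_Suc:
  "site_law (Suc N) x k l =
     p * site_law N (x + 1) (k - of_bool (x + 1 = 0)) (l - of_bool (x + 1 \<in> {-1, 1})) +
     q * site_law N (x - 1) (k - of_bool (x - 1 = 0)) (l - of_bool (x - 1 \<in> {-1, 1}))"
proof -
  have eq: "(of_bool (a + v = k \<and> b + w = l) :: real) = of_bool (v = k - a \<and> w = l - b)" for a b v w :: int
    by (rule arg_cong[where f = of_bool]) linarith
  show ?thesis
    unfolding site_law_def avg_Suc visits.simps eq by simp
qed

text \<open>\<open>T k l\<close> is the coefficient of \<open>s\<^sup>k u\<^sup>l\<close> in \<open>1 / (1 - q u - 2 p q s u)\<close>, and \<open>R k l\<close> that in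
  \<open>1 / (1 - q u)\<close>. Solving the first step equations for the joint generating function of the two
  local times and extracting coefficients gives \<open>H\<close> below; sites are shifted so that the
  observed one is \<open>0\<close> and the walk starts at \<open>x\<close>.\<close>

definition T :: "int \<Rightarrow> int \<Rightarrow> real" where
  "T k l = (if 0 \<le> k \<and> k \<le> l then real (nat l choose nat k) * q ^ (nat l - nat k) * (2 * p * q) ^ nat k else 0)"

definition R :: "int \<Rightarrow> int \<Rightarrow> real" where
  "R k l = (if k = 0 \<and> 0 \<le> l then q ^ nat l else 0)"

lemma R_rec: "R k l = q * R k (l - 1) + of_bool (k = 0 \<and> l = 0)"
proof (cases "l \<le> 0")
  case False
  then obtain n where "l = int (Suc n)"
    by (metis zero_less_imp_eq_int not_le gr0_implies_Suc)
  then show ?thesis by (auto simp: R_def nat_add_distrib)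
qed (auto simp: R_def)

lemma T_rec: "T k l = q * T k (l - 1) + 2 * p * q * T (k - 1) (l - 1) + of_bool (k = 0 \<and> l = 0)"
proof (cases "0 \<le> k \<and> k \<le> l")
  case False
  then show ?thesis by (auto simp: T_def)
next
  case True
  then obtain a b where ab: "k = int a" "l = int b" "a \<le> b"
    by (metis nonneg_int_cases zle_int order_trans)
  show ?thesis
  proof (cases b)
    case 0
    then show ?thesis using ab by (auto simp: T_def)
  next
    case b: (Suc c)
    show ?thesis
    proof (cases a)
      case 0
      then show ?thesis using ab b by (auto simp: T_def nat_add_distrib)
    next
      case a: (Suc d)
      have "d = c \<or> Suc d \<le> c" using ab a b by linarith
      then show ?thesis
      proof
        assume "d = c"
        then show ?thesis using ab a b by (auto simp: T_def nat_add_distrib)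
      next
        assume dc: "Suc d \<le> c"
        then have *: "c - d = Suc (c - Suc d)" by simp
        show ?thesis using ab a b dc by (auto simp: T_def * nat_add_distrib algebra_simps)
      qed
    qed
  qed
qed

lemma T_nonneg: "0 \<le> T k l"
  using p_pos q_pos by (auto simp: T_def)

text \<open>By the binomial theorem \<open>r ^ l\<close> is the sum of \<open>T k l\<close> over k,
  which makes \<open>r\<close> the geometric rate at which \<open>T\<close> decays in l.\<close>

definition r :: real where "r = q + 2 * p * q"

lemma r_pos: "0 < r" and r_less_1: "r < 1"
proof -
  show "0 < r" using p_pos q_pos by (simp add: r_def add_pos_pos)
  have "1 - r = (1 - q) * (1 - 2 * q)" using p_plus_q unfolding r_def by algebra
  also have "\<dots> > 0" using q_less_1 q_less_half by simp
  finally show "r < 1" by simp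
qed

lemma T_le_power: "T k (int n) \<le> r ^ n"
proof (induction n arbitrary: k)
  case 0
  then show ?case by (auto simp: T_def)
next
  case (Suc n)
  have "T k (int (Suc n)) = q * T k (int n) + 2 * p * q * T (k - 1) (int n)"
    by (subst T_rec) simp
  also have "\<dots> \<le> q * r ^ n + 2 * p * q * r ^ n"
    using Suc p_pos q_pos by (intro add_mono mult_left_mono) auto
  finally show ?case by (simp add: r_def algebra_simps)
qed

lemma T_le_1: "T k l \<le> 1"
proof (cases "0 \<le> l")
  case True
  then show ?thesis using T_le_power[of k "nat l"] power_le_one[of r "nat l"] r_pos r_less_1 by auto
qed (auto simp: T_def)

lemma R_nonneg: "0 \<le> R k l" and R_le_T: "R k l \<le> T k l"
  using T_nonneg[of k l] q_pos by (auto simp: R_def T_def)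

text \<open>The branches can be read off from excursions. From either neighbour the walk comes back
  to that neighbour before the site with probability q (from 1 as p * (q/p)); leaving the site and
  coming back carries the factor 2pq, summed over the two sides; the final exit from the site
  carries p (p - q). From -1 the first passage to the site contributes p in place of 2pq, hence p (p
  - q) / (2q). Below -1 the point -1 is hit surely, at the price of one neighbour visit; from x > 1
  the point 1 is hit with probability (q/p)^(x-1). \<open>R\<close> corrects the row k = 0: from
  below the site cannot be missed, from 1 it can.\<close>

definition H :: "int \<Rightarrow> int \<Rightarrow> int \<Rightarrow> real" where
  "H x k l =
    (if x \<le> -2 then p * (p - q) / (2 * q) * (T k (l - 1) - R k (l - 1))
     else if x = -1 then p * (p - q) / (2 * q) * (T k l - R k l)
     else if x = 0 then p * (p - q) * T k (l - 1)
     else if x = 1 then (p - q) / 2 * (T k l + R k l)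
     else (1 - (q / p) ^ nat (x - 1)) * of_bool (k = 0 \<and> l = 0)
        + (q / p) ^ nat (x - 1) * ((p - q) / 2 * (T k (l - 1) + R k (l - 1))))"

text \<open>The case split separates the places where a step changes the branch of \<open>H\<close>.
  At -1 and 1 the equation is the recursion of \<open>T\<close> and \<open>R\<close>; above 1 it
  says that a = q/p solves a = p a^2 + q.\<close>

lemma H_step:
  "H x k l =
     p * H (x + 1) (k - of_bool (x + 1 = 0)) (l - of_bool (x + 1 \<in> {-1, 1})) +
     q * H (x - 1) (k - of_bool (x - 1 = 0)) (l - of_bool (x - 1 \<in> {-1, 1}))"
proof -
  let ?d = "of_bool (k = 0 \<and> l = 0) :: real"
  consider "x \<le> -3" | "x = -2" | "x = -1" | "x = 0" | "x = 1" | "x = 2" | n where "x = int n + 3"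
  proof -
    assume a: "x \<le> -3 \<Longrightarrow> thesis" "x = -2 \<Longrightarrow> thesis" "x = -1 \<Longrightarrow> thesis" "x = 0 \<Longrightarrow> thesis" "x = 1 \<Longrightarrow> thesis" "x = 2 \<Longrightarrow> thesis"
     "\<And>n. x = int n + 3 \<Longrightarrow> thesis"
    show thesis using a a(7)[of "nat (x - 3)"] by linarith
  qed
  then show ?thesis
  proof cases
    case 1
    then have "H (x + 1) k l = H x k l" "H (x - 1) k l = H x k l"
      by (auto simp: H_def)
    then show ?thesis using 1 p_plus_q by (simp flip: distrib_right)
  next
    case 2
    then have "H (x + 1) k (l - 1) = H x k l" "H (x - 1) k l = H x k l"
      by (auto simp: H_def)
    then show ?thesis using 2 p_plus_q by (simp flip: distrib_right)
  next
    case 3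
    have "T k l - R k l = q * (T k (l - 1) - R k (l - 1)) + 2 * p * q * T (k - 1) (l - 1)"
      by (subst T_rec, subst R_rec) (simp add: algebra_simps)
    then have "p * (p - q) / (2 * q) * (T k l - R k l) =
        p * (p * (p - q) * T (k - 1) (l - 1)) + q * (p * (p - q) / (2 * q) * (T k (l - 1) - R k (l - 1)))"
      unfolding \<open>T k l - R k l = _\<close> using q_pos by (simp add: field_simps)
    then show ?thesis using 3 by (simp add: H_def)
  next
    case 4
    then show ?thesis using q_pos by (simp add: H_def field_simps)
  next
    case 5
    have "T k l + R k l = q * (T k (l - 1) + R k (l - 1)) + 2 * p * q * T (k - 1) (l - 1) + 2 * ?d"
      by (subst T_rec, subst R_rec) (simp add: algebra_simps)
    moreover have "p * (1 - q / p) = p - q" using p_pos by (simp add: field_simps)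
    ultimately have "(p - q) / 2 * (T k l + R k l) =
        p * ((1 - q / p) * ?d + q / p * ((p - q) / 2 * (T k (l - 1) + R k (l - 1)))) + q * (p * (p - q) * T (k - 1) (l - 1))"
      using p_pos by (simp add: field_simps)
    then show ?thesis using 5 by (simp add: H_def)
  next
    case 6
    have "H x k l = (1 - q / p) * ?d + q / p * ((p - q) / 2 * (T k (l - 1) + R k (l - 1)))"
      by (simp add: H_def 6)
    also have "\<dots> = p * ((1 - (q / p)^2) * ?d + (q / p)^2 * ((p - q) / 2 * (T k (l - 1) + R k (l - 1))))
      + q * ((p - q) / 2 * (T k (l - 1) + R k (l - 1)))"
    proof -
      have a: "1 - q / p = p * (1 - (q / p)^2)" using p_pos p_plus_q
        by (simp add: field_simps power2_eq_square) (simp add: p_eq algebra_simps)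
      have b: "q / p = p * (q / p)^2 + q" using p_pos p_plus_q
        by (simp add: field_simps power2_eq_square) (simp add: p_eq algebra_simps)
      have "(1 - q / p) * ?d + q / p * w = p * ((1 - (q / p)^2) * ?d + (q / p)^2 * w) + q * w" for w
        by (subst a, subst (2) b) (simp add: algebra_simps)
      then show ?thesis .
    qed
    finally show ?thesis by (simp add: H_def 6)
  next
    case (7 n)
    have e: "nat (2 + int n) = Suc (Suc n)" "nat (3 + int n) = Suc (Suc (Suc n))" "nat (1 + int n) = Suc n"
      by auto
    have c: "(q / p) ^ Suc (Suc n) = p * (q / p) ^ Suc (Suc (Suc n)) + q * (q / p) ^ Suc n"
    proof -
      have *: "a ^ Suc (Suc n) = p * a ^ Suc (Suc (Suc n)) + q * a ^ Suc n" if "a = p * a^2 + q" for a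
      proof -
        have "a ^ Suc (Suc n) = a ^ Suc n * a" by simp
        also have "\<dots> = a ^ Suc n * (p * a^2 + q)"
          by (rule arg_cong[OF that])
        also have "\<dots> = p * a ^ Suc (Suc (Suc n)) + q * a ^ Suc n"
          by (simp add: algebra_simps power2_eq_square)
        finally show ?thesis .
      qed
      show ?thesis
        using p_pos p_plus_q
        by (intro *) (simp add: field_simps power2_eq_square, simp add: p_eq algebra_simps)
    qed
    have "(1 - a) * ?d + a * w = p * ((1 - b) * ?d + b * w) + q * ((1 - c) * ?d + c * w)"
      if "a = p * b + q * c" for a b c w
      unfolding that p_eq by algebra
    from this[OF c, of "(p - q) / 2 * (T k (l - 1) + R k (l - 1))"] show ?thesis using 7 by (simp add: H_def e del: power_Suc)
  qed
qed

section \<open>The exponential weight and the truncation error\<close>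

definition lam :: real where "lam = sqrt (q / p)"
definition gam :: real where "gam = 2 * sqrt (p * q)"

lemma lam_pos: "0 < lam" and lam_less_1: "lam < 1"
  using p_pos q_pos q_less_p by (simp_all add: lam_def)

lemma gam_pos: "0 < gam" and gam_less_1: "gam < 1"
proof -
  show "0 < gam" using p_pos q_pos by (simp add: gam_def)
  have "1 - 4 * (p * q) = (1 - 2 * q)^2" by (simp add: p_eq power2_eq_square algebra_simps)
  also have "\<dots> > 0" using q_less_half by simp
  finally have "4 * (p * q) < 1" by simp
  then have "sqrt (4 * (p * q)) < 1" by simp
  then show "gam < 1" unfolding gam_def real_sqrt_mult by simp
qed

lemma lam_step: "p * lam + q / lam = gam"
proof -
  have "p * lam = sqrt (p * q)" "q / lam = sqrt (p * q)"
    using p_pos q_pos by (simp_all add: lam_def real_sqrt_divide real_sqrt_mult field_simps)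
  then show ?thesis by (simp add: gam_def)
qed

lemma avg_lam: "avg N (\<lambda>xs. lam powi (x + sum_list xs)) = lam powi x * gam ^ N"
proof (induction N arbitrary: x)
  case (Suc N)
  have "avg (Suc N) (\<lambda>xs. lam powi (x + sum_list xs))
      = p * (lam powi (x + 1) * gam ^ N) + q * (lam powi (x - 1) * gam ^ N)"
    unfolding Suc[symmetric] by (simp add: avg_Suc algebra_simps)
  also have "\<dots> = lam powi x * gam ^ N * (p * lam + q / lam)"
    using lam_pos by (simp add: power_int_add power_int_diff algebra_simps)
  finally show ?case by (simp add: lam_step)
qed simp

lemma H_nonneg: "0 \<le> H x k l" and H_le: "x \<le> 1 \<Longrightarrow> H x k l \<le> 1 / q"
proof -
  have c: "0 < p - q" "p - q < 1" "p * (p - q) < 1" "0 < p * (p - q)"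
    using q_less_p q_pos p_less_1 p_pos mult_strict_mono[of p 1 "p - q" 1] by auto
  have TR: "0 \<le> T k l - R k l" "T k l - R k l \<le> 1" "0 \<le> T k l + R k l" "T k l + R k l \<le> 2" for l
    using R_nonneg[of k l] R_le_T[of k l] T_le_1[of k l] T_nonneg[of k l] by auto
  have "0 \<le> (q / p) ^ n" "(q / p) ^ n \<le> 1" for n
    using p_pos q_pos q_less_p by (auto intro!: power_le_one)
  then show "0 \<le> H x k l"
    unfolding H_def using c q_pos TR T_nonneg[of k "l-1"] by (auto intro!: mult_nonneg_nonneg add_nonneg_nonneg divide_nonneg_nonneg)
  have q1: "1 \<le> 1 / q" using q_pos q_less_1 by simp
  have 1: "p * (p - q) / (2 * q) * t \<le> 1 / q" if "0 \<le> t" "t \<le> 1" for t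
  proof -
    have "p * (p - q) / (2 * q) * t \<le> p * (p - q) / (2 * q)"
      using that c q_pos by (intro mult_right_le_one_le) auto
    also have "\<dots> \<le> 2 / (2 * q)" using c q_pos by (intro divide_right_mono) auto
    also have "\<dots> = 1 / q" by simp
    finally show ?thesis .
  qed
  have 2: "p * (p - q) * T k (l - 1) \<le> 1" using c T_le_1[of k "l-1"] T_nonneg[of k "l-1"]
    mult_mono[of "p * (p-q)" 1 "T k (l - 1)" 1] by auto
  have 3: "(p - q) / 2 * (T k l + R k l) \<le> 1" 
    using c TR[of l] mult_mono[of "(p-q)/2" "1/2" "T k l + R k l" 2] by auto
  assume "x \<le> 1"
  then show "H x k l \<le> 1 / q"
    unfolding H_def using 1[OF TR(1,2), of l] 1[OF TR(1,2), of "l - 1"] 2 3 q1 by auto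
qed

text \<open>This is the truncation error at time 0. For x up to 1 the right side is at least 1/q,
  which dominates both terms. Beyond 1 the two terms differ only by the event of ever reaching 1,
  whose probability (q/p)^(x-1) is the square of \<open>lam ^ nat (x - 1)\<close>.\<close>

lemma H_start: "\<bar>of_bool (k = 0 \<and> l = 0) - H x k l\<bar> \<le> 1 / q * lam powi (x - 1)"
proof (cases "x \<le> 1")
  case True
  have "\<bar>of_bool (k = 0 \<and> l = 0) - H x k l\<bar> \<le> 1 / q"
    using H_nonneg[of x k l] H_le[OF True, of k l] q_pos q_less_1
    by (auto simp: abs_if of_bool_def) (smt (verit) le_divide_eq_1_pos)
  also have "\<dots> \<le> 1 / q * lam powi (x - 1)"
  proof -
    have "lam powi (x - 1) = inverse (lam ^ nat (1 - x))"
      using True by (simp add: power_int_def power_inverse)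
    also have "\<dots> \<ge> 1"
      using lam_pos lam_less_1 by (intro one_le_inverse) (auto intro: power_le_one)
    finally show ?thesis using q_pos by (simp add: divide_right_mono)
  qed
  finally show ?thesis .
next
  case False
  let ?d = "of_bool (k = 0 \<and> l = 0) :: real" and ?w = "(p - q) / 2 * (T k (l - 1) + R k (l - 1))"
  let ?n = "nat (x - 1)"
  have w: "0 \<le> ?w" "?w \<le> 1"
  proof -
    have "T k (l-1) + R k (l-1) \<le> 2" "0 \<le> T k (l-1) + R k (l-1)"
      using R_nonneg[of k "l-1"] R_le_T[of k "l-1"] T_le_1[of k "l-1"] T_nonneg[of k "l-1"] by auto
    then show "0 \<le> ?w" "?w \<le> 1"
      using q_less_p q_pos p_less_1 mult_mono[of "(p-q)/2" "1/2" "T k (l-1) + R k (l-1)" 2] by auto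
  qed
  have "?d - H x k l = (q / p) ^ ?n * (?d - ?w)"
    using False by (simp add: H_def algebra_simps)
  then have "\<bar>?d - H x k l\<bar> = (q / p) ^ ?n * \<bar>?d - ?w\<bar>"
    using p_pos q_pos by (simp add: abs_mult)
  also have "\<dots> \<le> (q / p) ^ ?n * 1"
    using w p_pos q_pos by (intro mult_left_mono) auto
  also have "\<dots> \<le> lam ^ ?n"
  proof -
    have "q / p = lam^2" using p_pos q_pos by (simp add: lam_def)
    also have "\<dots> \<le> lam" using lam_pos lam_less_1 by (simp add: power2_eq_square mult_le_one)
    finally show ?thesis using p_pos q_pos by (simp add: power_mono)
  qed
  also have "\<dots> \<le> 1 / q * lam ^ ?n"
    using lam_pos q_pos q_less_1 by (simp add: field_simps)
  also have "lam ^ ?n = lam powi (x - 1)" using False by (simp add: power_int_def)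
  finally show ?thesis .
qed

text \<open>The law of the pair of local times over the infinite future is the solution \<open>H\<close> of the first
  step equations. Truncating at time \<open>N\<close> costs an error that satisfies the first step
  inequality and is therefore dominated by the exponential supermartingale.\<close>

lemma site_law_approx: "\<bar>site_law N x k l - H x k l\<bar> \<le> 1 / q * lam powi (x - 1) * gam ^ N"
proof (induction N arbitrary: x k l)
  case 0
  then show ?case using H_start by (simp add: site_law_0)
next
  case (Suc N)
  have "\<bar>p * (a - a') + q * (b - b')\<bar> \<le> p * A + q * B" if "\<bar>a - a'\<bar> \<le> A" "\<bar>b - b'\<bar> \<le> B" for a a' b b' A B
  proof -
    have "\<bar>p * (a - a') + q * (b - b')\<bar> \<le> p * \<bar>a - a'\<bar> + q * \<bar>b - b'\<bar>"
      using p_pos q_pos abs_triangle_ineq[of "p * (a - a')" "q * (b - b')"] by (simp add: abs_mult)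
    also have "\<dots> \<le> p * A + q * B" using that p_pos q_pos by (intro add_mono mult_left_mono) auto
    finally show ?thesis .
  qed
  from this[OF Suc[of "x + 1" "k - of_bool (x + 1 = 0)" "l - of_bool (x + 1 \<in> {-1, 1})"]
      Suc[of "x - 1" "k - of_bool (x - 1 = 0)" "l - of_bool (x - 1 \<in> {-1, 1})"]]
  have "\<bar>site_law (Suc N) x k l - H x k l\<bar> \<le> p * (1 / q * lam powi x * gam ^ N) + q * (1 / q * lam powi (x - 2) * gam ^ N)"
    by (subst site_law_Suc, subst H_step) (simp add: algebra_simps)
  also have "\<dots> = 1 / q * lam powi (x - 1) * gam ^ N * (p * lam + q / lam)"
    using lam_pos by (simp add: power_int_diff field_simps power2_eq_square)
  finally show ?case by (simp add: lam_step mult_ac)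
qed

end

section \<open>The random walk\<close>

locale drift_walk = prob_space M + drift p q
  for M :: "'a measure" and p q :: real +
  fixes X :: "nat \<Rightarrow> 'a \<Rightarrow> int"
  assumes X_measurable: "\<And>i. i \<ge> 1 \<Longrightarrow> X i \<in> measurable M (count_space UNIV)"
    and X_indep: "indep_vars (\<lambda>_. count_space UNIV) X {1..}"
    and X_up: "\<And>i. i \<ge> 1 \<Longrightarrow> prob {\<omega> \<in> space M. X i \<omega> = 1} = p"
    and X_down: "\<And>i. i \<ge> 1 \<Longrightarrow> prob {\<omega> \<in> space M. X i \<omega> = -1} = q"
begin

abbreviation S :: "nat \<Rightarrow> 'a \<Rightarrow> int" where "S \<equiv> walk X"

definition inc :: "nat \<Rightarrow> nat \<Rightarrow> 'a \<Rightarrow> int list" where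
  "inc t N \<omega> = map (\<lambda>i. X i \<omega>) [Suc t..<Suc (t + N)]"

lemma inc_0 [simp]: "inc t 0 \<omega> = []"
  by (simp add: inc_def)

lemma inc_Suc: "inc t (Suc N) \<omega> = X (Suc t) \<omega> # inc (Suc t) N \<omega>"
  unfolding inc_def by (subst upt_conv_Cons) auto

lemma inc_take: "take n (inc t (n + N) \<omega>) = inc t n \<omega>"
  and inc_drop: "drop n (inc t (n + N) \<omega>) = inc (t + n) N \<omega>"
  by (simp_all add: inc_def take_map drop_map add.assoc del: upt_Suc)

lemma walk_Suc: "S (Suc t) \<omega> = S t \<omega> + X (Suc t) \<omega>"
  by (simp add: walk_def)

lemma walk_add: "S (t + N) \<omega> = S t \<omega> + sum_list (inc t N \<omega>)"
proof (induction N arbitrary: t)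
  case (Suc N)
  show ?case using Suc[of "Suc t"] by (simp add: inc_Suc walk_Suc)
qed simp

lemma visits_inc:
  "visits A (S t \<omega> - z) (inc t N \<omega>) = int (card {i. t < i \<and> i \<le> t + N \<and> S i \<omega> - z \<in> A})"
proof (induction N arbitrary: t)
  case (Suc N)
  have "{i. t < i \<and> i \<le> t + Suc N \<and> S i \<omega> - z \<in> A} =
      (if S (Suc t) \<omega> - z \<in> A then {Suc t} else {}) \<union> {i. Suc t < i \<and> i \<le> Suc t + N \<and> S i \<omega> - z \<in> A}"
    (is "_ = ?a \<union> ?b")
  proof (rule set_eqI)
    fix i
    show "i \<in> {i. t < i \<and> i \<le> t + Suc N \<and> S i \<omega> - z \<in> A} \<longleftrightarrow> i \<in> ?a \<union> ?b"
    proof (cases "i = Suc t")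
      case False
      then have "t < i \<longleftrightarrow> Suc t < i" by linarith
      with False show ?thesis by simp
    qed simp
  qed
  moreover have "finite ?b" by (rule finite_subset[of _ "{..Suc t + N}"]) auto
  then have "card (?a \<union> ?b) = card ?a + card ?b" by (intro card_Un_disjoint) auto
  moreover have "S t \<omega> - z + X (Suc t) \<omega> = S (Suc t) \<omega> - z" by (simp add: walk_Suc)
  then have "visits A (S t \<omega> - z) (inc t (Suc N) \<omega>) =
      of_bool (S (Suc t) \<omega> - z \<in> A) + visits A (S (Suc t) \<omega> - z) (inc (Suc t) N \<omega>)"
    unfolding inc_Suc visits.simps by (simp only:)
  ultimately show ?case by (simp add: Suc[of "Suc t"])
qed simp

lemma inc_measurable: "inc t N \<in> measurable M (count_space UNIV)"
proof (induction N arbitrary: t)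
  case (Suc N)
  have "(\<lambda>\<omega>. X (Suc t) \<omega> # inc (Suc t) N \<omega>) \<in> measurable M (count_space UNIV)"
    by (rule measurable_compose_countable[where g = "X (Suc t)", OF measurable_compose[OF Suc]])
      (auto intro: X_measurable)
  then show ?case by (simp add: inc_Suc[abs_def])
qed (simp add: inc_0[abs_def])

lemma inc_event [measurable]: "{\<omega> \<in> space M. P (inc t N \<omega>)} \<in> sets M"
  using measurable_sets[OF inc_measurable, of "{xs. P xs}" t N] by (simp add: vimage_def Int_def conj_commute)

lemma AE_steps: "AE \<omega> in M. \<forall>i\<ge>1. X i \<omega> \<in> {1, -1}"
proof -
  have "AE \<omega> in M. X i \<omega> \<in> {1, -1}" if "i \<ge> 1" for i
  proof -
    have [measurable]: "X i \<in> measurable M (count_space UNIV)" using X_measurable that .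
    have "{\<omega> \<in> space M. X i \<omega> \<in> {1, -1}} = {\<omega> \<in> space M. X i \<omega> = 1} \<union> {\<omega> \<in> space M. X i \<omega> = -1}"
      by auto
    also have "prob \<dots> = p + q"
      unfolding X_up[OF that, symmetric] X_down[OF that, symmetric]
      by (rule finite_measure_Union) auto
    finally have "prob {\<omega> \<in> space M. X i \<omega> \<in> {1, -1}} = 1"
      by (simp only: p_plus_q)
    then show ?thesis by (subst (asm) prob_eq_1) auto
  qed
  then show ?thesis by (auto simp: AE_all_countable)
qed

lemma prob_inc_eq:
  assumes "xs \<in> paths N"
  shows "prob {\<omega> \<in> space M. inc t N \<omega> = xs} = wt xs"
proof (cases "N = 0")
  case True
  then show ?thesis using assms by (simp add: prob_space)
next
  case False
  let ?J = "{Suc t..t + N}"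
  have len: "length xs = N" and mem: "\<And>i. i < N \<Longrightarrow> xs ! i = 1 \<or> xs ! i = -1"
    using assms nth_mem by (fastforce simp: paths_def)+
  have "{\<omega> \<in> space M. inc t N \<omega> = xs} = (\<Inter>j\<in>?J. X j -` {xs ! (j - Suc t)} \<inter> space M)"
  proof -
    have "inc t N \<omega> = xs \<longleftrightarrow> (\<forall>j\<in>?J. X j \<omega> = xs ! (j - Suc t))" for \<omega>
    proof
      assume "inc t N \<omega> = xs"
      then show "\<forall>j\<in>?J. X j \<omega> = xs ! (j - Suc t)"
        using len by (auto simp: inc_def simp del: upt_Suc)
    next
      assume *: "\<forall>j\<in>?J. X j \<omega> = xs ! (j - Suc t)"
      show "inc t N \<omega> = xs"
        by (rule nth_equalityI) (use * len in \<open>auto simp: inc_def simp del: upt_Suc\<close>)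
    qed
    then show ?thesis using False by auto
  qed
  also have "prob \<dots> = (\<Prod>j\<in>?J. prob (X j -` {xs ! (j - Suc t)} \<inter> space M))"
    using False by (intro indep_varsD[OF X_indep]) auto
  also have "\<dots> = (\<Prod>j\<in>?J. if xs ! (j - Suc t) = 1 then p else q)"
  proof (rule prod.cong[OF refl])
    fix j assume j: "j \<in> ?J"
    have "X j -` {a} \<inter> space M = {\<omega> \<in> space M. X j \<omega> = a}" for a by auto
    then show "prob (X j -` {xs ! (j - Suc t)} \<inter> space M) = (if xs ! (j - Suc t) = 1 then p else q)"
      using mem[of "j - Suc t"] j X_up[of j] X_down[of j] by auto
  qed
  also have "\<dots> = (\<Prod>i<N. if xs ! i = 1 then p else q)"
    by (rule prod.reindex_bij_witness[where i = "\<lambda>i. i + Suc t" and j = "\<lambda>j. j - Suc t"]) auto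
  also have "\<dots> = wt xs"
    by (simp add: wt_def prod.list_conv_set_nth len lessThan_atLeast0)
  finally show ?thesis .
qed

text \<open>Transfer to the path sums: every event that depends on \<open>N\<close> consecutive
  steps has a probability given by \<open>avg\<close>, and the starting time drops out because the
  steps are identically distributed.\<close>

lemma prob_inc: "prob {\<omega> \<in> space M. P (inc t N \<omega>)} = avg N (\<lambda>xs. of_bool (P xs))"
proof -
  let ?Q = "{xs \<in> paths N. P xs}"
  have "AE \<omega> in M. inc t N \<omega> \<in> paths N"
    using AE_steps 
  proof eventually_elim
    case (elim \<omega>)
    then have "X i \<omega> \<in> {1, -1}" if "i \<in> {Suc t..<Suc (t + N)}" for i
      using that by auto
    then show ?case by (simp add: inc_def paths_def image_subset_iff del: upt_Suc)
  qed
  then have "prob {\<omega> \<in> space M. P (inc t N \<omega>)} = prob (\<Union>xs\<in>?Q. {\<omega> \<in> space M. inc t N \<omega> = xs})"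
    by (intro finite_measure_eq_AE) auto
  also have "\<dots> = (\<Sum>xs\<in>?Q. prob {\<omega> \<in> space M. inc t N \<omega> = xs})"
    by (rule finite_measure_finite_Union) (auto simp: disjoint_family_on_def)
  also have "\<dots> = (\<Sum>xs\<in>?Q. wt xs)"
    by (rule sum.cong) (auto simp: prob_inc_eq)
  also have "\<dots> = (\<Sum>xs\<in>paths N. if P xs then wt xs else 0)"
    by (rule sum.inter_filter) simp
  also have "\<dots> = avg N (\<lambda>xs. of_bool (P xs))"
    unfolding avg_def by (rule sum.cong) auto
  finally show ?thesis .
qed

text \<open>Chernoff bound: since \<open>lam\<close> is below 1, the weight \<open>lam\<close> to
  the power (sum - y) is at least 1 on the event, and its mean is known from
  \<open>avg_lam\<close>.\<close>

lemma prob_inc_sum_le: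
  "prob {\<omega> \<in> space M. real_of_int (sum_list (inc t N \<omega>)) \<le> y} \<le> lam powr (- y) * gam ^ N"
proof -
  have "avg N (\<lambda>xs. of_bool (real_of_int (sum_list xs) \<le> y)) \<le> avg N (\<lambda>xs. lam powr (- y) * lam powi (0 + sum_list xs))"
  proof (rule avg_mono)
    fix xs
    have "lam powr (- y) * lam powi (0 + sum_list xs) = lam powr (real_of_int (sum_list xs) - y)"
      using lam_pos by (simp add: powr_diff powr_minus powr_real_of_int' field_simps)
    also have "\<dots> \<ge> 1" if "real_of_int (sum_list xs) \<le> y"
      using that lam_pos lam_less_1 powr_mono'[of "real_of_int (sum_list xs) - y" 0 lam] by simp
    moreover have "0 \<le> lam powr (real_of_int (sum_list xs) - y)" by simp
    ultimately show "of_bool (real_of_int (sum_list xs) \<le> y) \<le> lam powr (- y) * lam powi (0 + sum_list xs)"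
      by auto
  qed
  then show ?thesis unfolding avg_cmult avg_lam by (simp add: prob_inc[of "\<lambda>xs. real_of_int (sum_list xs) \<le> y"])
qed

text \<open>The slope with \<open>lam powr \<beta> = gam\<close>: at level
  \<open>\<beta> * N\<close> the Chernoff bound for \<open>N\<close> steps equals 1, so any deficit
  below this line is a pure gain.\<close>

definition \<beta> :: real where "\<beta> = ln gam / ln lam"
text \<open>A deficit of \<open>\<alpha> * ln t\<close> gains the factor t^(-3), which is still
  summable over t after a union over the t + 1 values of s.\<close>

definition \<alpha> :: real where "\<alpha> = - 3 / ln lam"

lemma \<beta>_pos: "0 < \<beta>" and \<alpha>_pos: "0 < \<alpha>"
  using lam_pos lam_less_1 gam_pos gam_less_1 by (auto simp: \<beta>_def \<alpha>_def divide_neg_neg)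

text \<open>Serves two purposes. Read backwards from t, it limits by \<open>\<alpha> * ln t\<close>
  how far the walk lies below its earlier maximum. Read forwards from s, it excludes returns once
  the linear term dominates.\<close>

lemma AE_drift:
  "AE \<omega> in M. \<exists>t0. \<forall>t\<ge>t0. \<forall>s\<le>t. \<beta> * (real t - real s) - \<alpha> * ln (real t) \<le> S t \<omega> - S s \<omega>"
proof -
  define A where "A t = (\<Union>s\<in>{..t}. {\<omega> \<in> space M.
    real_of_int (sum_list (inc s (t - s) \<omega>)) \<le> \<beta> * (real t - real s) - \<alpha> * ln (real t)})" for t
  have bd: "prob (A t) \<le> 2 / real t ^ 2" if "t \<ge> 1" for t
  proof -
    have "prob (A t) \<le> (\<Sum>s\<in>{..t}. prob {\<omega> \<in> space M.
        real_of_int (sum_list (inc s (t - s) \<omega>)) \<le> \<beta> * (real t - real s) - \<alpha> * ln (real t)})"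
      unfolding A_def by (rule finite_measure_subadditive_finite) auto
    also have "\<dots> \<le> (\<Sum>s\<in>{..t}. 1 / real t ^ 3)"
    proof (rule sum_mono)
      fix s assume s: "s \<in> {..t}"
      have l: "ln lam \<noteq> 0" using lam_pos lam_less_1 by simp
      have "prob {\<omega> \<in> space M. real_of_int (sum_list (inc s (t - s) \<omega>)) \<le> \<beta> * (real t - real s) - \<alpha> * ln (real t)}
         \<le> lam powr (- (\<beta> * (real t - real s) - \<alpha> * ln (real t))) * gam ^ (t - s)"
        by (rule prob_inc_sum_le)
      also have "gam ^ (t - s) = exp (ln gam * real (t - s))"
        using gam_pos by (simp add: powr_def mult.commute flip: powr_realpow)
      also have "lam powr (- (\<beta> * (real t - real s) - \<alpha> * ln (real t))) * exp (ln gam * real (t - s)) = exp (- 3 * ln (real t))"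
        using s l lam_pos unfolding powr_def by (simp add: \<beta>_def \<alpha>_def field_simps flip: exp_add)
      also have "\<dots> = 1 / real t ^ 3"
        using that exp_of_nat_mult[of 3 "ln (real t)"] by (simp add: exp_minus inverse_eq_divide)
      finally show "prob {\<omega> \<in> space M. real_of_int (sum_list (inc s (t - s) \<omega>)) \<le> \<beta> * (real t - real s) - \<alpha> * ln (real t)}
         \<le> 1 / real t ^ 3" .
    qed
    also have "\<dots> = (1 + real t) / real t ^ 3" by simp
    also have "\<dots> \<le> 2 / real t ^ 2" using that by (simp add: field_simps eval_nat_numeral)
    finally show ?thesis .
  qed
  have "AE \<omega> in M. eventually (\<lambda>t. \<omega> \<in> space M - A t) sequentially"
  proof (rule borel_cantelli_AE1)
    show "summable (\<lambda>t. prob (A t))"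
    proof (rule summable_comparison_test_ev)
      show "eventually (\<lambda>t. norm (prob (A t)) \<le> 2 / real t ^ 2) sequentially"
        using eventually_ge_at_top[of 1] by eventually_elim (simp add: bd)
      show "summable (\<lambda>t. 2 / real t ^ 2)"
        using summable_mult[OF inverse_power_summable[of 2], of 2] by (simp add: field_simps)
    qed
  qed (auto simp: A_def less_top[symmetric])
  then show ?thesis
  proof eventually_elim
    case (elim \<omega>)
    then obtain t0 where t0: "\<And>t. t \<ge> t0 \<Longrightarrow> \<omega> \<in> space M - A t"
      by (auto simp: eventually_sequentially)
    show ?case
    proof (intro exI[of _ t0] allI impI)
      fix t s assume "t0 \<le> t" "s \<le> t"
      then have "\<not> real_of_int (sum_list (inc s (t - s) \<omega>)) \<le> \<beta> * (real t - real s) - \<alpha> * ln (real t)"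
        using t0[of t] by (auto simp: A_def)
      then show "\<beta> * (real t - real s) - \<alpha> * ln (real t) \<le> S t \<omega> - S s \<omega>"
        using walk_add[of s "t - s" \<omega>] \<open>s \<le> t\<close> by simp
    qed
  qed
qed

end

section \<open>Comparison with the rate function\<close>

lemma xlogx_mult: "0 < c \<Longrightarrow> 0 \<le> t \<Longrightarrow> xlogx (c * t) = c * xlogx t + c * t * ln c"
  by (auto simp: xlogx_def ln_mult algebra_simps)

lemma gfun_scale:
  assumes "0 < c" "0 \<le> x" "x \<le> y"
  shows "gfun p q (c * x) (c * y) = c * gfun p q x y"
  using assms xlogx_mult[of c x] xlogx_mult[of c y] xlogx_mult[of c "y - x"]
  by (simp add: gfun_def algebra_simps)

lemma mem_scaleD_iff:
  assumes "0 < c"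
  shows "(x, y) \<in> scaleD c (Dset p q) \<longleftrightarrow> 0 \<le> x \<and> x \<le> y \<and> gfun p q x y \<le> c"
proof
  assume "(x, y) \<in> scaleD c (Dset p q)"
  then obtain a b where "x = c * a" "y = c * b" "a \<le> b" "0 \<le> a" "gfun p q a b \<le> 1"
    by (auto simp: scaleD_def Dset_def)
  then show "0 \<le> x \<and> x \<le> y \<and> gfun p q x y \<le> c"
    using assms by (simp add: gfun_scale)
next
  assume *: "0 \<le> x \<and> x \<le> y \<and> gfun p q x y \<le> c"
  have "c * gfun p q (x / c) (y / c) = gfun p q x y"
    using gfun_scale[of c "x / c" "y / c" p q] * assms by (simp add: divide_right_mono)
  then have "gfun p q (x / c) (y / c) \<le> 1"
    using * assms by (metis mult.right_neutral mult_le_cancel_left_pos)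
  then have "(x / c, y / c) \<in> Dset p q"
    using * assms by (simp add: Dset_def divide_right_mono)
  then show "(x, y) \<in> scaleD c (Dset p q)"
    using assms unfolding scaleD_def by (intro CollectI exI[of _ "x / c"] exI[of _ "y / c"]) simp
qed

text \<open>Together with \<open>ln_fact_le\<close> a crude Stirling formula, proved by telescoping
  the tangent bound for \<open>ln\<close>. Errors of order ln n are affordable, as they only produce
  polynomial factors.\<close>

lemma ln_fact_ge: "xlogx (real n) - real n \<le> ln (fact n)"
proof (induction n)
  case (Suc n)
  show ?case
  proof (cases "n = 0")
    case False
    then have "ln (real (Suc n)) - ln (real n) \<le> (real (Suc n) - real n) / real n"
      by (intro ln_diff_le) auto
    then have "real n * (ln (real (Suc n)) - ln (real n)) \<le> 1"
      using False by (simp add: field_simps)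
    moreover have "ln (fact (Suc n) :: real) = ln (real (Suc n)) + ln (fact n)"
      by (simp add: ln_mult del: of_nat_Suc)
    ultimately show ?thesis using Suc False by (simp add: xlogx_def algebra_simps)
  qed (simp add: xlogx_def)
qed (simp add: xlogx_def)

lemma ln_fact_le: "ln (fact n) \<le> xlogx (real n) - real n + 1 + ln (real n + 1)"
proof -
  have "ln (fact (Suc n)) \<le> (real (Suc n) + 1) * ln (real (Suc n)) - real (Suc n) + 1" for n
  proof (induction n)
    case (Suc n)
    let ?x = "real (Suc n)" and ?y = "real (Suc (Suc n))"
    have "ln ?x - ln ?y \<le> (?x - ?y) / ?y"
      by (intro ln_diff_le) auto
    then have "1 \<le> ?y * (ln ?y - ln ?x)"
      by (simp add: field_simps)
    moreover have "ln (fact (Suc (Suc n)) :: real) = ln ?y + ln (fact (Suc n))"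
      by (subst fact_Suc, subst ln_mult) (auto simp del: fact_Suc of_nat_Suc)
    ultimately show ?case using Suc by (simp add: algebra_simps del: fact_Suc)
  qed simp
  then have "ln (fact n) \<le> (real n + 1) * ln (real n) - real n + 1" if "n > 0"
    using that gr0_implies_Suc by blast
  moreover have "(real n + 1) * ln (real n) \<le> xlogx (real n) + ln (real n + 1)" if "n > 0"
    using that by (simp add: xlogx_def algebra_simps)
  ultimately show ?thesis by (cases "n = 0") (auto simp: xlogx_def)
qed

lemma ln_binomial_bounds:
  assumes "k \<le> l"
  defines "E \<equiv> xlogx (real l) - xlogx (real k) - xlogx (real l - real k)"
  shows "E - 2 - 2 * ln (real l + 1) \<le> ln (real (l choose k))"
    and "ln (real (l choose k)) \<le> E + 1 + ln (real l + 1)"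
proof -
  have "real (l choose k) = fact l / (fact k * fact (l - k))"
    using assms by (simp add: binomial_fact)
  then have eq: "ln (real (l choose k)) = ln (fact l) - ln (fact k) - ln (fact (l - k))"
    by (simp add: ln_div ln_mult)
  have "ln (real k + 1) \<le> ln (real l + 1)" "ln (real l - real k + 1) \<le> ln (real l + 1)"
    using assms by auto
  moreover have d: "real (l - k) = real l - real k" using assms(1) by (rule of_nat_diff)
  moreover note ln_fact_ge[of l] ln_fact_ge[of k] ln_fact_ge[of "l - k", unfolded d]
    ln_fact_le[of l] ln_fact_le[of k] ln_fact_le[of "l - k", unfolded d]
  ultimately have "E - 2 - 2 * ln (real l + 1) \<le> ln (real (l choose k)) \<and>
      ln (real (l choose k)) \<le> E + 1 + ln (real l + 1)"
    unfolding eq E_def by linarith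
  then show "E - 2 - 2 * ln (real l + 1) \<le> ln (real (l choose k))"
    "ln (real (l choose k)) \<le> E + 1 + ln (real l + 1)"
    by blast+
qed

context drift
begin

section \<open>The size of \<open>T\<close> in terms of the rate function\<close>

lemma T_pos: "k \<le> l \<Longrightarrow> 0 < T (int k) (int l)"
  using p_pos q_pos by (simp add: T_def)

text \<open>\<open>T\<close> carries the factor q^l (2p)^k, which cancels the linear terms of
  \<open>gfun\<close> exactly; what remains is the binomial coefficient against its entropy.\<close>

lemma ln_T_bounds:
  assumes "k \<le> l"
  shows "- 2 - 2 * ln (real l + 1) \<le> ln (T (int k) (int l)) + gfun p q (real k) (real l)"
    and "ln (T (int k) (int l)) + gfun p q (real k) (real l) \<le> 1 + ln (real l + 1)"
proof -
  have "ln (T (int k) (int l)) = ln (real (l choose k)) + real (l - k) * ln q + real k * (ln (2 * p) + ln q)"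
    using assms p_pos q_pos by (simp add: T_def ln_mult ln_realpow)
  then have "ln (T (int k) (int l)) + gfun p q (real k) (real l) =
     ln (real (l choose k)) - (xlogx (real l) - xlogx (real k) - xlogx (real l - real k))"
    using assms by (simp add: gfun_def of_nat_diff algebra_simps)
  then show "- 2 - 2 * ln (real l + 1) \<le> ln (T (int k) (int l)) + gfun p q (real k) (real l)"
    "ln (T (int k) (int l)) + gfun p q (real k) (real l) \<le> 1 + ln (real l + 1)"
    using ln_binomial_bounds[OF assms] by auto
qed

lemma T_ge:
  assumes "k \<le> l" "gfun p q (real k) (real l) \<le> c"
  shows "exp (- c - 2) / (real l + 1)^2 \<le> T (int k) (int l)"
proof -
  have "- c - 2 - 2 * ln (real l + 1) \<le> ln (T (int k) (int l))"
    using ln_T_bounds(1)[OF assms(1)] assms(2) by linarith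
  then have "exp (- c - 2 - 2 * ln (real l + 1)) \<le> T (int k) (int l)"
    using T_pos[OF assms(1)] by (metis exp_le_cancel_iff exp_ln)
  also have "exp (- c - 2 - 2 * ln (real l + 1)) = exp (- c - 2) / (real l + 1)^2"
    using exp_of_nat_mult[of 2 "ln (real l + 1)"] by (simp add: exp_diff)
  finally show ?thesis .
qed

text \<open>A bound by exp(-t) that is uniform in (k, l) cannot be summed over all pairs. Splitting
  \<open>T\<close> into its powers \<open>\<theta>\<close> and 1 - \<open>\<theta>\<close> uses the
  threshold on the first factor and the geometric decay of \<open>T_le_power\<close> on the second,
  which pays for the summation.\<close>

lemma T_le_tail:
  assumes "k \<le> l" "t \<le> gfun p q (real k) (real l)" "0 < \<theta>" "\<theta> < 1"
  shows "T (int k) (int l) \<le> exp (1 - \<theta> * t) * ((real l + 1) * (r powr (1 - \<theta>)) ^ l)"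
proof -
  let ?u = "ln (T (int k) (int l))"
  have "T (int k) (int l) = exp (\<theta> * ?u + (1 - \<theta>) * ?u)"
    using T_pos[OF assms(1)] by (simp add: algebra_simps)
  also have "\<dots> \<le> exp ((1 - \<theta> * t + ln (real l + 1)) + (1 - \<theta>) * (real l * ln r))"
  proof -
    have "\<theta> * ?u \<le> \<theta> * (1 + ln (real l + 1) - t)"
      using ln_T_bounds(2)[OF assms(1)] assms(2,3) by (intro mult_left_mono) auto
    also have "\<dots> \<le> 1 - \<theta> * t + ln (real l + 1)"
      using mult_right_mono[of \<theta> 1 "1 + ln (real l + 1)"] assms(4) by (simp add: algebra_simps)
    finally have 1: "\<theta> * ?u \<le> 1 - \<theta> * t + ln (real l + 1)" .
    have "?u \<le> ln (r ^ l)"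
      using T_le_power[of "int k" l] T_pos[OF assms(1)] r_pos by (subst ln_le_cancel_iff) auto
    then have "(1 - \<theta>) * ?u \<le> (1 - \<theta>) * (real l * ln r)"
      using assms(4) r_pos by (intro mult_left_mono) (auto simp: ln_realpow)
    with 1 show ?thesis by simp
  qed
  also have "exp ((1 - \<theta> * t + ln (real l + 1)) + (1 - \<theta>) * (real l * ln r))
     = exp (1 - \<theta> * t) * ((real l + 1) * (r powr (1 - \<theta>)) ^ l)"
    using r_pos by (simp add: exp_add powr_def mult_ac flip: exp_of_nat_mult)
  finally show ?thesis .
qed

text \<open>The domain is bounded: \<open>T\<close> is at most exp(-4 \<open>\<kappa>\<close> l), so
  \<open>gfun\<close> grows linearly in l. Half of this rate is spent on 2 ln(l+1), through a
  tangent line of \<open>ln\<close> with slope \<open>\<kappa>\<close>.\<close>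

lemma length_le_of_gfun_le:
  assumes "k \<le> l" "gfun p q (real k) (real l) \<le> c"
  defines "\<kappa> \<equiv> - ln r / 4"
  shows "real l \<le> (c + 2 * \<kappa> + 2 - 2 * ln \<kappa>) / (2 * \<kappa>)"
proof -
  have \<kappa>: "0 < \<kappa>" using r_pos r_less_1 by (simp add: \<kappa>_def)
  have "ln (T (int k) (int l)) \<le> ln (r ^ l)"
    using T_le_power[of "int k" l] T_pos[OF assms(1)] r_pos by (subst ln_le_cancel_iff) auto
  then have "ln (T (int k) (int l)) \<le> - 4 * \<kappa> * real l"
    using r_pos by (simp add: ln_realpow \<kappa>_def mult.commute)
  moreover have "ln (real l + 1) \<le> (real l + 1) * \<kappa> - 1 - ln \<kappa>"
    using ln_le_minus_one[of "(real l + 1) * \<kappa>"] \<kappa> by (simp add: ln_mult)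
  ultimately have "2 * \<kappa> * real l \<le> c + 2 * \<kappa> + 2 - 2 * ln \<kappa>"
    using ln_T_bounds(1)[OF assms(1)] assms(2) by (simp add: algebra_simps)
  then show ?thesis using \<kappa> by (simp add: field_simps)
qed

section \<open>Estimates for a single site approached from below\<close>

definition site_const :: real where "site_const = p * (p - q) / (2 * q)"

lemma site_const_pos: "0 < site_const"
  using p_pos q_pos q_less_p by (simp add: site_const_def)

lemma H_upper: "x \<le> -2 \<Longrightarrow> H x k l \<le> site_const / q * T k l"
proof -
  assume "x \<le> -2"
  then have "H x k l = site_const * (T k (l - 1) - R k (l - 1))"
    by (simp add: H_def site_const_def)
  also have "\<dots> \<le> site_const * T k (l - 1)"
    using site_const_pos R_nonneg[of k "l - 1"] by simp
  also have "T k (l - 1) \<le> T k l / q"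
  proof -
    have "q * T k (l - 1) \<le> T k l"
      using T_nonneg[of "k - 1" "l - 1"] p_pos q_pos by (subst (2) T_rec) simp
    then show ?thesis using q_pos by (simp add: field_simps)
  qed
  finally show ?thesis using site_const_pos by (simp add: mult_left_mono)
qed

text \<open>Of the surplus (1, 2), one neighbour visit is the arrival at -1, and the remaining (1,
  1) is one more step 2pq in the recursion of \<open>T\<close>. With at least one visit to the site
  the correction \<open>R\<close> vanishes.\<close>

lemma H_lower:
  assumes "x \<le> -2" "0 \<le> k"
  shows "2 * p * q * site_const * T k l \<le> H x (k + 1) (l + 2)"
proof -
  have "2 * p * q * T k l \<le> T (k + 1) (l + 1)"
    using T_nonneg[of "k + 1" l] p_pos q_pos by (subst (2) T_rec) simp
  then have "site_const * (2 * p * q * T k l) \<le> site_const * T (k + 1) (l + 1)"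
    using site_const_pos by (intro mult_left_mono) auto
  moreover have "R (k + 1) (l + 1) = 0" using assms by (simp add: R_def)
  moreover have "H x (k + 1) (l + 2) = site_const * (T (k + 1) (l + 2 - 1) - R (k + 1) (l + 2 - 1))"
    using assms by (simp add: H_def site_const_def)
  moreover have "l + 2 - 1 = l + 1" by simp
  ultimately show ?thesis by (simp only: mult_ac diff_zero)
qed

definition site_bad :: "real \<Rightarrow> int \<Rightarrow> int list \<Rightarrow> bool" where
  "site_bad t z xs \<longleftrightarrow> 1 \<le> visits {0} (- z) xs \<and> visits {0} (- z) xs \<le> visits {-1, 1} (- z) xs \<and>
     t < gfun p q (real_of_int (visits {0} (- z) xs)) (real_of_int (visits {-1, 1} (- z) xs))"

text \<open>The constant is uniform in z, N and t because \<open>H_upper\<close> does not depend on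
  the starting point below -1. The truncation error is paid once per pair, and N steps allow at most
  (N+1)^2 pairs.\<close>

lemma site_bad_avg:
  assumes \<theta>: "0 < \<theta>" "\<theta> < 1"
  shows "\<exists>C\<ge>0. \<forall>z N t. 2 \<le> z \<longrightarrow> avg N (\<lambda>xs. of_bool (site_bad t z xs)) \<le>
       C * exp (- \<theta> * t) + (real N + 1)^2 * (1 / q * lam powi (- z - 1) * gam ^ N)"
proof -
  define w where "w = r powr (1 - \<theta>)"
  have w: "0 \<le> w" "w < 1"
    using r_pos r_less_1 \<theta> powr_less_mono2[of "1 - \<theta>" r 1] by (auto simp: w_def)
  have sm: "summable (\<lambda>l. (real l + 1)^2 * w ^ l)"
  proof (cases "w = 0")
    case True
    show ?thesis
      by (rule summable_finite[of "{0}"]) (auto simp: True)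
  next
    case False
    then have "0 < w" using w by simp
    with w(2) have "eventually (\<lambda>l. (real l + 1)^2 * w ^ l \<le> 1 / real l ^ 2) sequentially"
      by real_asymp
    then have "eventually (\<lambda>l. norm ((real l + 1)^2 * w ^ l) \<le> 1 / real l ^ 2) sequentially"
      by eventually_elim (use w in simp)
    moreover have "summable (\<lambda>l. 1 / real l ^ 2)"
      using inverse_power_summable[of 2] by (simp add: field_simps)
    ultimately show ?thesis by (rule summable_comparison_test_ev)
  qed
  define C where "C = site_const / q * exp 1 * (\<Sum>l. (real l + 1)^2 * w ^ l)"
  have "0 \<le> C"
    unfolding C_def using site_const_pos q_pos w sm by (intro mult_nonneg_nonneg suminf_nonneg) auto
  moreover have "avg N (\<lambda>xs. of_bool (site_bad t z xs)) \<le>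
      C * exp (- \<theta> * t) + (real N + 1)^2 * (1 / q * lam powi (- z - 1) * gam ^ N)"
    if z: "2 \<le> z" for z N t
  proof -
  let ?err = "1 / q * lam powi (- z - 1) * gam ^ N"
  have err: "0 \<le> ?err" using q_pos lam_pos gam_pos by simp
  let ?I = "SIGMA l:{..N}. {k\<in>{..l}. t < gfun p q (real k) (real l)}"
  have fin: "finite ?I" by auto
  have "avg N (\<lambda>xs. of_bool (site_bad t z xs)) \<le>
      avg N (\<lambda>xs. \<Sum>(l, k)\<in>?I. of_bool (visits {0} (- z) xs = int k \<and> visits {-1, 1} (- z) xs = int l))"
  proof (rule avg_mono)
    fix xs assume "xs \<in> paths N"
    then have len: "length xs = N" by (simp add: paths_def)
    let ?f = "\<lambda>(l, k). (of_bool (visits {0} (- z) xs = int k \<and> visits {-1, 1} (- z) xs = int l) :: real)"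
    show "of_bool (site_bad t z xs) \<le> sum ?f ?I"
    proof (cases "site_bad t z xs")
      case True
      define k l where "k = nat (visits {0} (- z) xs)" and "l = nat (visits {-1, 1} (- z) xs)"
      have kl: "visits {0} (- z) xs = int k" "visits {-1, 1} (- z) xs = int l"
        using visits_nonneg by (auto simp: k_def l_def)
      have "(l, k) \<in> ?I"
        using True visits_le[of "{-1, 1}" "- z" xs] len unfolding site_bad_def kl by auto
      then have "sum ?f {(l, k)} \<le> sum ?f ?I"
        using fin by (intro sum_mono2) auto
      then show ?thesis using kl by auto
    qed (auto intro!: sum_nonneg)
  qed
  also have "\<dots> = (\<Sum>(l, k)\<in>?I. site_law N (- z) (int k) (int l))"
    unfolding site_law_def avg_sum case_prod_unfold ..
  also have "\<dots> \<le> (\<Sum>(l, k)\<in>?I. site_const / q * (exp (1 - \<theta> * t) * ((real l + 1) * w ^ l)) + ?err)"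
  proof (rule sum_mono)
    fix y assume "y \<in> ?I"
    then obtain l k where y: "y = (l, k)" and lk: "k \<in> {..l}" "t < gfun p q (real k) (real l)" by auto
    have "site_law N (- z) (int k) (int l) \<le> H (- z) (int k) (int l) + ?err"
      using site_law_approx[of N "- z" "int k" "int l"] by (simp add: abs_le_iff)
    also have "H (- z) (int k) (int l) \<le> site_const / q * T (int k) (int l)"
      using z by (intro H_upper) auto
    also have "T (int k) (int l) \<le> exp (1 - \<theta> * t) * ((real l + 1) * w ^ l)"
      unfolding w_def using lk \<theta> by (intro T_le_tail) auto
    finally show "(case y of (l, k) \<Rightarrow> site_law N (- z) (int k) (int l)) \<le>
       (case y of (l, k) \<Rightarrow> site_const / q * (exp (1 - \<theta> * t) * ((real l + 1) * w ^ l)) + ?err)"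
      unfolding y using site_const_pos q_pos by (simp add: mult_left_mono divide_right_mono)
  qed
  \<comment> \<open>The threshold has been used in the summand; dropping it from the index set
    leaves rows of exactly l + 1 entries.\<close>
  also have "\<dots> \<le> (\<Sum>(l, k)\<in>(SIGMA l:{..N}. {..l}). site_const / q * (exp (1 - \<theta> * t) * ((real l + 1) * w ^ l)) + ?err)"
    using err w site_const_pos q_pos by (intro sum_mono2) auto
  also have "\<dots> = (\<Sum>l\<le>N. (real l + 1) * (site_const / q * (exp (1 - \<theta> * t) * ((real l + 1) * w ^ l)) + ?err))"
    by (subst sum.Sigma[symmetric]) (auto simp: add.commute)
  also have "\<dots> = site_const / q * exp (1 - \<theta> * t) * (\<Sum>l\<le>N. (real l + 1)^2 * w ^ l) + ?err * (\<Sum>l\<le>N. real l + 1)"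
    unfolding sum_distrib_left sum.distrib[symmetric]
    by (rule sum.cong) (simp_all add: power2_eq_square algebra_simps add_divide_distrib)
  also have "\<dots> \<le> site_const / q * exp (1 - \<theta> * t) * (\<Sum>l. (real l + 1)^2 * w ^ l) + ?err * (\<Sum>l\<le>N. real N + 1)"
    using sm w err site_const_pos q_pos
    by (intro add_mono mult_left_mono sum_le_suminf sum_mono) auto
  also have "\<dots> = C * exp (- \<theta> * t) + (real N + 1)^2 * ?err"
    by (simp add: C_def exp_diff exp_minus power2_eq_square field_simps)
  finally show ?thesis .
  qed
  ultimately show ?thesis by blast
qed

text \<open>Independence of disjoint blocks, obtained by peeling off the first block with
  \<open>avg_split\<close>.\<close>

lemma avg_blocks:
  "avg (m * B) (\<lambda>xs. of_bool (\<forall>i<m. P (take B (drop (i * B) xs)))) = avg B (\<lambda>xs. of_bool (P xs)) ^ m"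
proof (induction m)
  case (Suc m)
  have "avg (Suc m * B) (\<lambda>xs. of_bool (\<forall>i<Suc m. P (take B (drop (i * B) xs)))) =
      avg (B + m * B) (\<lambda>xs. of_bool (P (take B xs)) * of_bool (\<forall>i<m. P (take B (drop (i * B) (drop B xs)))))"
    by (simp add: All_less_Suc2 add.commute of_bool_conj)
  also have "\<dots> = avg B (\<lambda>xs. of_bool (P xs)) * avg B (\<lambda>xs. of_bool (P xs)) ^ m"
    by (subst avg_split[where f = "\<lambda>xs. of_bool (P xs)" and g = "\<lambda>xs. of_bool (\<forall>i<m. P (take B (drop (i * B) xs)))"]) (simp add: Suc)
  finally show ?case by simp
qed simp

end

context drift_walk
begin

lemma prob_blocks:
  "prob {\<omega> \<in> space M. \<forall>i<m. P (inc (i * B) B \<omega>)} = avg B (\<lambda>xs. of_bool (P xs)) ^ m"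
proof -
  have "take B (drop (i * B) (inc 0 (m * B) \<omega>)) = inc (i * B) B \<omega>" if im: "i < m" for i \<omega>
  proof -
    obtain d where "m = Suc (i + d)" using im less_imp_Suc_add by blast
    then have "m * B = i * B + (B + d * B)" by (simp add: algebra_simps)
    then show ?thesis
      using inc_drop[of "i * B" 0 "B + d * B" \<omega>] inc_take[of B "i * B" "d * B" \<omega>] by simp
  qed
  then have "{\<omega> \<in> space M. \<forall>i<m. P (inc (i * B) B \<omega>)} = {\<omega> \<in> space M. \<forall>i<m. P (take B (drop (i * B) (inc 0 (m * B) \<omega>)))}"
    by auto
  then show ?thesis using prob_inc[of "\<lambda>xs. \<forall>i<m. P (take B (drop (i * B) xs))" 0 "m * B"] by (simp only: avg_blocks)
qed

end

section \<open>The outer bound\<close>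

context drift_walk
begin

text \<open>The bridge from infinite-time counts to step lists. The outer bound applies it to a
  window that starts at time 0, the inner bound to a single block.\<close>

lemma local_times_window:
  assumes "\<And>k. 1 \<le> k \<Longrightarrow> k \<le> a \<or> a + N < k \<Longrightarrow> S k \<omega> \<notin> {z - 1, z, z + 1}"
  shows "int (loc_time X z \<omega>) = visits {0} (S a \<omega> - z) (inc a N \<omega>)"
    and "int (nb_loc_time X z \<omega>) = visits {-1, 1} (S a \<omega> - z) (inc a N \<omega>)"
proof -
  have eq: "{k. k \<ge> 1 \<and> S k \<omega> = y} = {i. a < i \<and> i \<le> a + N \<and> S i \<omega> = y}" if "y \<in> {z - 1, z, z + 1}" for y
    using assms that by (auto simp: not_le[symmetric] intro: ccontr)
  have fin: "finite {i. a < i \<and> i \<le> a + N \<and> Q i}" for Q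
    by (rule finite_subset[of _ "{..a + N}"]) auto
  show "int (loc_time X z \<omega>) = visits {0} (S a \<omega> - z) (inc a N \<omega>)"
    unfolding loc_time_def visits_inc by (subst eq) auto
  have "nb_loc_time X z \<omega> = card ({i. a < i \<and> i \<le> a + N \<and> S i \<omega> = z - 1} \<union> {i. a < i \<and> i \<le> a + N \<and> S i \<omega> = z + 1})"
    unfolding nb_loc_time_def loc_time_def
    by (subst (1 2) eq, simp, simp, rule card_Un_disjoint[symmetric]) (use fin in auto)
  also have "{i. a < i \<and> i \<le> a + N \<and> S i \<omega> = z - 1} \<union> {i. a < i \<and> i \<le> a + N \<and> S i \<omega> = z + 1}
      = {i. a < i \<and> i \<le> a + N \<and> S i \<omega> - z \<in> {-1, 1}}"
    by auto
  finally show "int (nb_loc_time X z \<omega>) = visits {-1, 1} (S a \<omega> - z) (inc a N \<omega>)"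
    unfolding visits_inc by simp
qed

lemma walk_0 [simp]: "S 0 \<omega> = 0"
  by (simp add: walk_def)

lemma abs_walk_le:
  assumes "\<forall>i\<ge>1. X i \<omega> \<in> {1, -1}"
  shows "\<bar>S t \<omega>\<bar> \<le> int t"
proof (induction t)
  case (Suc t)
  have "\<bar>X (Suc t) \<omega>\<bar> \<le> 1" using assms[rule_format, of "Suc t"] by auto
  with Suc show ?case by (simp add: walk_Suc)
qed simp

text \<open>The moment after a visit to the site is a visit to a neighbour. Finiteness matters since
  \<open>card\<close> of an infinite set is 0.\<close>

lemma loc_time_le_nb:
  assumes steps: "\<forall>i\<ge>1. X i \<omega> \<in> {1, -1}" and fin: "\<And>y. finite {k. k \<ge> 1 \<and> S k \<omega> = y}"
  shows "loc_time X z \<omega> \<le> nb_loc_time X z \<omega>"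
proof -
  have "Suc ` {k. k \<ge> 1 \<and> S k \<omega> = z} \<subseteq> {k. k \<ge> 1 \<and> S k \<omega> = z - 1} \<union> {k. k \<ge> 1 \<and> S k \<omega> = z + 1}"
    using steps by (auto simp: walk_Suc)
  then have "card (Suc ` {k. k \<ge> 1 \<and> S k \<omega> = z}) \<le> card ({k. k \<ge> 1 \<and> S k \<omega> = z - 1} \<union> {k. k \<ge> 1 \<and> S k \<omega> = z + 1})"
    using fin by (intro card_mono) auto
  also have "\<dots> \<le> nb_loc_time X z \<omega>"
    unfolding nb_loc_time_def loc_time_def by (rule card_Un_le)
  finally show ?thesis by (simp add: card_image loc_time_def)
qed

text \<open>The window of length z^2 makes \<open>gam ^ z\<^sup>2\<close> beat the exponential
  factor \<open>lam powi (- z - 1)\<close>, and it is long enough for the drift to carry the walk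
  beyond z + 1.\<close>

lemma AE_sites_good:
  assumes "0 < \<epsilon>"
  shows "AE \<omega> in M. \<exists>z0. \<forall>z\<ge>z0. \<not> site_bad ((1 + \<epsilon>) * ln (real z)) (int z) (inc 0 (z\<^sup>2) \<omega>)"
proof -
  \<comment> \<open>Any value strictly between 1/(1 + \<open>\<epsilon>\<close>) and 1 would do: the
    series over z then has an exponent below -1.\<close>
  define \<theta> where "\<theta> = 1 / (1 + \<epsilon> / 2)"
  have \<theta>: "0 < \<theta>" "\<theta> < 1" using assms by (auto simp: \<theta>_def field_simps)
  obtain C where "0 \<le> C" and C: "\<And>z N t. 2 \<le> z \<Longrightarrow> avg N (\<lambda>xs. of_bool (site_bad t z xs)) \<le>
       C * exp (- \<theta> * t) + (real N + 1)^2 * (1 / q * lam powi (- z - 1) * gam ^ N)"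
    using site_bad_avg[OF \<theta>] by blast
  define A where "A z = {\<omega> \<in> space M. site_bad ((1 + \<epsilon>) * ln (real z)) (int z) (inc 0 (z\<^sup>2) \<omega>)}" for z
  define a b where "a = - ln lam" and "b = - ln gam"
  have ab: "0 < a" "0 < b" using lam_pos lam_less_1 gam_pos gam_less_1 by (auto simp: a_def b_def)
  have bd: "prob (A z) \<le> C * real z powr (- \<theta> * (1 + \<epsilon>)) + (real z ^ 2 + 1)^2 * (1 / q * exp (a * (real z + 1)) * exp (- b * real z ^ 2))"
    if z: "2 \<le> z" for z
  proof -
    have "prob (A z) \<le> C * exp (- \<theta> * ((1 + \<epsilon>) * ln (real z))) + (real (z\<^sup>2) + 1)^2 * (1 / q * lam powi (- int z - 1) * gam ^ z\<^sup>2)"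
      unfolding A_def by (subst prob_inc[of "site_bad _ _"], rule C) (use z in auto)
    also have "exp (- \<theta> * ((1 + \<epsilon>) * ln (real z))) = real z powr (- \<theta> * (1 + \<epsilon>))"
      using z by (simp add: powr_def mult_ac)
    also have "lam powi (- int z - 1) = exp (a * (real z + 1))"
    proof -
      have "lam powi (- int z - 1) = lam powr (- real z - 1)"
        using lam_pos powr_real_of_int'[of lam "- int z - 1"] by simp
      also have "\<dots> = exp (a * (real z + 1))"
        unfolding powr_def using lam_pos by (simp add: a_def algebra_simps)
      finally show ?thesis .
    qed
    also have "gam ^ z\<^sup>2 = exp (- b * real z ^ 2)"
      using gam_pos powr_realpow[of gam "z\<^sup>2"] by (simp add: powr_def b_def mult_ac)
    finally show ?thesis by simp
  qed
  have "AE \<omega> in M. eventually (\<lambda>z. \<omega> \<in> space M - A z) sequentially"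
  proof (rule borel_cantelli_AE1)
    have "eventually (\<lambda>z. (real z ^ 2 + 1)^2 * (1 / q * exp (a * (real z + 1)) * exp (- b * real z ^ 2)) \<le> 1 / real z ^ 2) sequentially"
      using ab q_pos by real_asymp
    then have "eventually (\<lambda>z. norm (prob (A z)) \<le> C * real z powr (- \<theta> * (1 + \<epsilon>)) + 1 / real z ^ 2) sequentially"
      using eventually_ge_at_top[of 2] by eventually_elim (use bd in fastforce)
    moreover have "summable (\<lambda>z. C * real z powr (- \<theta> * (1 + \<epsilon>)) + 1 / real z ^ 2)"
    proof (intro summable_add summable_mult)
      have "- \<theta> * (1 + \<epsilon>) < - 1" using assms by (simp add: \<theta>_def field_simps)
      then show "summable (\<lambda>z. real z powr (- \<theta> * (1 + \<epsilon>)))"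
        by (simp only: summable_real_powr_iff)
      show "summable (\<lambda>z. 1 / real z ^ 2)"
        using inverse_power_summable[of 2] by (simp add: field_simps)
    qed
    ultimately show "summable (\<lambda>z. prob (A z))"
      by (rule summable_comparison_test_ev)
  qed (auto simp: A_def less_top[symmetric] intro: inc_event)
  then show ?thesis
    by eventually_elim (auto simp: eventually_sequentially A_def)
qed

text \<open>The threshold of a good site involves ln z and not ln n. A positive site visited by time
  n is at most n, so one estimate per site serves all later n.\<close>

lemma upper_part:
  assumes \<epsilon>: "0 < \<epsilon>"
  shows "AE \<omega> in M. \<exists>n0::nat. \<forall>n\<ge>n0. \<forall>j\<in>{1..n}.
        (real (loc_time X (walk X j \<omega>) \<omega>), real (nb_loc_time X (walk X j \<omega>) \<omega>))
          \<in> scaleD ((1 + \<epsilon>) * ln (real n)) (Dset p q)"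
  using AE_steps AE_drift AE_sites_good[OF \<epsilon>]
proof eventually_elim
  case (elim \<omega>)
  let ?g = "\<lambda>z. gfun p q (real (loc_time X z \<omega>)) (real (nb_loc_time X z \<omega>))"
  from elim obtain t0 where t0: "\<And>t s. t0 \<le> t \<Longrightarrow> s \<le> t \<Longrightarrow> \<beta> * (real t - real s) - \<alpha> * ln (real t) \<le> S t \<omega> - S s \<omega>"
    by blast
  from elim obtain z0 where z0: "\<And>z. z0 \<le> z \<Longrightarrow> \<not> site_bad ((1 + \<epsilon>) * ln (real z)) (int z) (inc 0 (z\<^sup>2) \<omega>)"
    by blast
  have "eventually (\<lambda>t. \<beta> / 2 * real t < \<beta> * real t - \<alpha> * ln (real t)) sequentially"
    using \<alpha>_pos \<beta>_pos by real_asymp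
  then obtain t1 where t1: "\<And>t. t1 \<le> t \<Longrightarrow> \<beta> / 2 * real t < \<beta> * real t - \<alpha> * ln (real t)"
    by (auto simp: eventually_sequentially)
  have grow: "\<beta> / 2 * real t < S t \<omega>" if "t0 \<le> t" "t1 \<le> t" for t
  proof -
    have "\<beta> * real t - \<alpha> * ln (real t) \<le> S t \<omega>" using t0[OF that(1), of 0] by simp
    with t1[OF that(2)] show ?thesis by linarith
  qed
  have fin_le: "finite {k. S k \<omega> \<le> y}" for y
  proof -
    have "k \<le> t0 + t1 + nat \<lceil>2 * \<bar>real_of_int y\<bar> / \<beta>\<rceil>" if "S k \<omega> \<le> y" for k
    proof (rule ccontr)
      assume k: "\<not> ?thesis"
      then have "2 * \<bar>real_of_int y\<bar> / \<beta> \<le> real k" by linarith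
      then have "\<bar>real_of_int y\<bar> \<le> \<beta> / 2 * real k" using \<beta>_pos by (simp add: field_simps)
      then show False using grow[of k] k that by linarith
    qed
    then show ?thesis by (auto intro: finite_subset[of _ "{.._}"])
  qed
  have fin: "finite {k. k \<ge> 1 \<and> S k \<omega> = y}" for y
    by (rule finite_subset[OF _ fin_le[of y]]) auto
  have "eventually (\<lambda>z. real z + 1 < \<beta> / 2 * real z ^ 2) sequentially"
    using \<beta>_pos by real_asymp
  moreover have "eventually (\<lambda>z. real t0 + real t1 < real z ^ 2) sequentially"
    by real_asymp
  ultimately have "eventually (\<lambda>z. real z + 1 < \<beta> / 2 * real z ^ 2 \<and> real t0 + real t1 < real z ^ 2 \<and> max z0 1 \<le> z) sequentially"
    using eventually_ge_at_top[of "max z0 1"] by eventually_elim simp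
  then obtain z1 where z1: "\<And>z. z1 \<le> z \<Longrightarrow> real z + 1 < \<beta> / 2 * real z ^ 2 \<and> real t0 + real t1 < real z ^ 2 \<and> max z0 1 \<le> z"
    by (auto simp: eventually_sequentially)
  \<comment> \<open>Sites up to \<open>z1\<close>, negative ones included, are visited at finitely
    many times only; the largest value of \<open>gfun\<close> there is a constant, which (1 +
    \<open>\<epsilon>\<close>) ln n eventually exceeds.\<close>
  define J where "J = {k. S k \<omega> \<le> int z1}"
  define G where "G = Max (insert 0 ((\<lambda>j. ?g (S j \<omega>)) ` J))"
  have G: "?g (S j \<omega>) \<le> G" if "S j \<omega> \<le> int z1" for j
    unfolding G_def using that fin_le[of "int z1"] by (intro Max_ge) (auto simp: J_def)
  have big: "?g z \<le> (1 + \<epsilon>) * ln (real n)" if z: "int z1 < z" "z = S j \<omega>" and j: "j \<in> {1..n}" for z j n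
  proof -
    define y where "y = nat z"
    have zy: "z = int y" "z1 \<le> y" using z by (auto simp: y_def)
    have yn: "y \<le> n" using abs_walk_le[OF elim(1), of j] j z(2) zy by auto
    have y1: "1 \<le> y" "z0 \<le> y" using z1[OF zy(2)] by auto
    have out: "S k \<omega> \<notin> {z - 1, z, z + 1}" if "1 \<le> k" "k \<le> 0 \<or> 0 + y\<^sup>2 < k" for k
    proof -
      have k: "real y ^ 2 < real k" using that by (metis not_one_le_zero le_trans add_0 of_nat_less_iff of_nat_power)
      then have "t0 \<le> k \<and> t1 \<le> k" using z1[OF zy(2)] by linarith
      then have "\<beta> / 2 * real k < S k \<omega>" using grow by blast
      moreover have "\<beta> / 2 * real y ^ 2 \<le> \<beta> / 2 * real k" using k \<beta>_pos by simp
      ultimately have "real y + 1 < S k \<omega>" using z1[OF zy(2)] by linarith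
      then show ?thesis using zy by auto
    qed
    have loc: "int (loc_time X z \<omega>) = visits {0} (- z) (inc 0 (y\<^sup>2) \<omega>)"
        "int (nb_loc_time X z \<omega>) = visits {-1, 1} (- z) (inc 0 (y\<^sup>2) \<omega>)"
      using local_times_window[of 0 "y\<^sup>2" \<omega> z, OF out] by simp_all
    have "loc_time X z \<omega> > 0"
      unfolding loc_time_def using fin[of z] z j by (subst card_gt_0_iff) auto
    moreover have "loc_time X z \<omega> \<le> nb_loc_time X z \<omega>"
      by (rule loc_time_le_nb[OF elim(1) fin])
    ultimately have "?g z \<le> (1 + \<epsilon>) * ln (real y)"
      using z0[OF y1(2)] zy(1) unfolding site_bad_def zy(1)[symmetric] loc[symmetric] by auto
    also have "\<dots> \<le> (1 + \<epsilon>) * ln (real n)" using y1 yn \<epsilon> by simp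
    finally show ?thesis .
  qed
  have "eventually (\<lambda>n. G \<le> (1 + \<epsilon>) * ln (real n)) sequentially"
    using \<epsilon> by real_asymp
  then obtain n0 where n0: "\<And>n. n0 \<le> n \<Longrightarrow> G \<le> (1 + \<epsilon>) * ln (real n)"
    by (auto simp: eventually_sequentially)
  show ?case
  proof (intro exI[of _ "max n0 2"] allI impI ballI)
    fix n j assume n: "max n0 2 \<le> n" and j: "j \<in> {1..n}"
    have "0 < (1 + \<epsilon>) * ln (real n)" using n \<epsilon> by simp
    moreover have "loc_time X (S j \<omega>) \<omega> \<le> nb_loc_time X (S j \<omega>) \<omega>"
      by (rule loc_time_le_nb[OF elim(1) fin])
    moreover have "?g (S j \<omega>) \<le> (1 + \<epsilon>) * ln (real n)"
      using big[OF _ refl j] G[of j] n0[of n] n by (cases "int z1 < S j \<omega>") auto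
    ultimately show "(real (loc_time X (S j \<omega>) \<omega>), real (nb_loc_time X (S j \<omega>) \<omega>))
          \<in> scaleD ((1 + \<epsilon>) * ln (real n)) (Dset p q)"
      by (simp add: mem_scaleD_iff)
  qed
qed

end

section \<open>The inner bound\<close>

context drift_walk
begin

text \<open>The first summand makes \<open>gam ^ block_len n\<close> at most n^(-5), for the
  truncation error; the second makes the drift over one block at least 6 \<open>\<alpha>\<close> ln
  n, for the escape above the observed site.\<close>

definition \<eta> :: real where "\<eta> = - 5 / ln gam + 6 * \<alpha> / \<beta>"
text \<open>Height of the observed site above the position at the start of a block. By
  \<open>AE_drift\<close> the past reaches at most \<open>\<alpha>\<close> ln n above that position;
  the extra 3 keeps the lower neighbour out of its reach as well.\<close>

definition site_off :: "nat \<Rightarrow> nat" where "site_off n = nat \<lceil>\<alpha> * ln (real n)\<rceil> + 3"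
definition block_len :: "nat \<Rightarrow> nat" where "block_len n = nat \<lceil>\<eta> * ln (real n)\<rceil> + 1"

definition block_ok :: "nat \<Rightarrow> nat \<Rightarrow> nat \<Rightarrow> int list \<Rightarrow> bool" where
  "block_ok n k l xs \<longleftrightarrow> visits {0} (- int (site_off n)) xs = int k + 1 \<and>
     visits {-1, 1} (- int (site_off n)) xs = int l + 2"

lemma \<eta>_pos: "0 < \<eta>" and \<eta>_gam: "\<eta> * ln gam \<le> - 5" and \<eta>_drift: "6 * \<alpha> \<le> \<eta> * \<beta>"
proof -
  have lg: "ln gam < 0" using gam_pos gam_less_1 by simp
  have a: "0 < - 5 / ln gam" and b: "0 < 6 * \<alpha> / \<beta>"
    using lg \<alpha>_pos \<beta>_pos by (auto simp: divide_neg_neg)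
  show "0 < \<eta>" unfolding \<eta>_def using a b by linarith
  have "\<eta> * ln gam = - 5 / ln gam * ln gam + 6 * \<alpha> / \<beta> * ln gam"
    unfolding \<eta>_def by (rule distrib_right)
  also have "- 5 / ln gam * ln gam = - 5" using lg by simp
  also have "6 * \<alpha> / \<beta> * ln gam \<le> 0"
    using b lg by (intro mult_nonneg_nonpos) auto
  finally show "\<eta> * ln gam \<le> - 5" by simp
  have "\<eta> * \<beta> = - 5 / ln gam * \<beta> + 6 * \<alpha> / \<beta> * \<beta>"
    unfolding \<eta>_def by (rule distrib_right)
  also have "6 * \<alpha> / \<beta> * \<beta> = 6 * \<alpha>" using \<beta>_pos by simp
  finally have "\<eta> * \<beta> = - 5 / ln gam * \<beta> + 6 * \<alpha>" .
  moreover have "0 \<le> - 5 / ln gam * \<beta>"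
    using a \<beta>_pos by (intro mult_nonneg_nonneg) auto
  ultimately show "6 * \<alpha> \<le> \<eta> * \<beta>" by linarith
qed

lemma site_off_ge: "3 \<le> site_off n" and block_len_pos: "0 < block_len n"
  unfolding site_off_def block_len_def by simp_all

lemma site_off_bounds:
  assumes "1 \<le> n"
  shows "\<alpha> * ln (real n) + 3 \<le> real (site_off n)" "real (site_off n) \<le> \<alpha> * ln (real n) + 4"
proof -
  have "0 \<le> \<alpha> * ln (real n)" using \<alpha>_pos assms by simp
  then show "\<alpha> * ln (real n) + 3 \<le> real (site_off n)" "real (site_off n) \<le> \<alpha> * ln (real n) + 4"
    unfolding site_off_def by linarith+
qed

lemma block_len_bounds:
  assumes "1 \<le> n"
  shows "\<eta> * ln (real n) + 1 \<le> real (block_len n)" "real (block_len n) \<le> \<eta> * ln (real n) + 2"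
proof -
  have "0 \<le> \<eta> * ln (real n)" using \<eta>_pos assms by simp
  then show "\<eta> * ln (real n) + 1 \<le> real (block_len n)" "real (block_len n) \<le> \<eta> * ln (real n) + 2"
    unfolding block_len_def by linarith+
qed

text \<open>The offset costs a factor of order n^3 and the block length gains n^(-5). The resulting
  n^(-2) is negligible against a success probability of about n^(-(1 -
  \<open>\<epsilon>\<close>)).\<close>

lemma truncation_error:
  assumes n: "1 \<le> n"
  shows "1 / q * lam powi (- int (site_off n) - 1) * gam ^ block_len n \<le> 1 / q * lam powr (- 5) / real n ^ 2"
proof -
  have "lam powi (- int (site_off n) - 1) = lam powr (- real (site_off n) - 1)"
    using lam_pos powr_real_of_int'[of lam "- int (site_off n) - 1"] by simp
  also have "\<dots> \<le> lam powr (- 5 - \<alpha> * ln (real n))"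
    using lam_pos lam_less_1 site_off_bounds[OF n] by (intro powr_mono') auto
  also have "\<dots> = lam powr (- 5) * exp (3 * ln (real n))"
    using lam_pos lam_less_1 by (simp add: powr_def \<alpha>_def left_diff_distrib exp_diff exp_minus divide_inverse)
  finally have 1: "lam powi (- int (site_off n) - 1) \<le> lam powr (- 5) * exp (3 * ln (real n))" .
  have "gam ^ block_len n = gam powr real (block_len n)"
    using gam_pos by (simp add: powr_realpow)
  also have "\<dots> \<le> gam powr (\<eta> * ln (real n))"
    using gam_pos gam_less_1 block_len_bounds[OF n] by (intro powr_mono') auto
  also have "\<dots> = exp ((\<eta> * ln gam) * ln (real n))"
    using gam_pos by (simp add: powr_def mult_ac)
  also have "\<dots> \<le> exp (- 5 * ln (real n))"
    unfolding exp_le_cancel_iff using n by (intro mult_right_mono \<eta>_gam) auto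
  finally have 2: "gam ^ block_len n \<le> exp (- 5 * ln (real n))" .
  have "lam powi (- int (site_off n) - 1) * gam ^ block_len n
      \<le> lam powr (- 5) * exp (3 * ln (real n)) * exp (- 5 * ln (real n))"
    using 1 2 gam_pos by (intro mult_mono) auto
  also have "\<dots> = lam powr (- 5) * exp (- 2 * ln (real n))"
    by (simp flip: exp_add)
  also have "exp (- 2 * ln (real n)) = 1 / real n ^ 2"
    using n exp_of_nat_mult[of 2 "ln (real n)"] by (simp add: exp_minus inverse_eq_divide)
  finally have "1 / q * (lam powi (- int (site_off n) - 1) * gam ^ block_len n) \<le> 1 / q * (lam powr (- 5) * (1 / real n ^ 2))"
    using q_pos by (intro mult_left_mono) auto
  then show ?thesis by simp
qed

lemma prob_block_ok_ge:
  assumes n: "1 \<le> n" and kl: "k \<le> l" "gfun p q (real k) (real l) \<le> c"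
  shows "2 * p * q * site_const * (exp (- c - 2) / (real l + 1)^2) - 1 / q * lam powr (- 5) / real n ^ 2
     \<le> avg (block_len n) (\<lambda>xs. of_bool (block_ok n k l xs))"
proof -
  let ?x = "- int (site_off n)"
  have "2 * p * q * site_const * (exp (- c - 2) / (real l + 1)^2) \<le> 2 * p * q * site_const * T (int k) (int l)"
    using T_ge[OF kl] p_pos q_pos site_const_pos by (intro mult_left_mono) auto
  also have "\<dots> \<le> H ?x (int k + 1) (int l + 2)"
    using site_off_ge[of n] by (intro H_lower) auto
  also have "\<dots> \<le> site_law (block_len n) ?x (int k + 1) (int l + 2) + 1 / q * lam powr (- 5) / real n ^ 2"
    using site_law_approx[of "block_len n" ?x "int k + 1" "int l + 2"] truncation_error[OF n] by linarith
  finally show ?thesis by (simp add: site_law_def block_ok_def)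
qed

lemma prob_no_block_le:
  "prob {\<omega> \<in> space M. \<forall>i<m. \<not> P (inc (i * B) B \<omega>)} \<le> exp (- (real m * avg B (\<lambda>xs. of_bool (P xs))))"
proof -
  let ?h = "avg B (\<lambda>xs. of_bool (P xs))"
  have "avg B (\<lambda>xs. of_bool (\<not> P xs)) = avg B (\<lambda>xs. 1 - of_bool (P xs))"
    by (rule avg_cong) auto
  then have eq: "avg B (\<lambda>xs. of_bool (\<not> P xs)) = 1 - ?h" by (simp add: avg_diff)
  have "?h \<le> 1" using avg_mono[of B "\<lambda>xs. of_bool (P xs)" "\<lambda>_. 1"] by simp
  then have "(1 - ?h) ^ m \<le> exp (- ?h) ^ m"
    using exp_ge_add_one_self[of "- ?h"] by (intro power_mono) auto
  then show ?thesis
    using prob_blocks[of m "\<lambda>xs. \<not> P xs" B] by (simp add: eq flip: exp_of_nat_mult)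
qed

text \<open>The expected number of successful blocks grows like n^\<open>\<epsilon>\<close> up to
  logarithmic factors. Only a lower bound 5 ln n is used: the failure probability n^(-5) of each
  pair beats the at most (n+1)^2 pairs.\<close>

lemma AE_block_ok:
  assumes \<epsilon>: "0 < \<epsilon>" "\<epsilon> < 1"
  shows "AE \<omega> in M. \<exists>n0. \<forall>n\<ge>n0. \<forall>k l. k \<le> l \<longrightarrow> gfun p q (real k) (real l) \<le> (1 - \<epsilon>) * ln (real n) \<longrightarrow>
     (\<exists>i<n div block_len n. block_ok n k l (inc (i * block_len n) (block_len n) \<omega>))"
proof -
  define \<kappa> where "\<kappa> = - ln r / 4"
  have \<kappa>: "0 < \<kappa>" using r_pos r_less_1 by (simp add: \<kappa>_def)
  define K where "K = 1 / (2 * \<kappa>)"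
  define d where "d = \<bar>2 * \<kappa> + 2 - 2 * ln \<kappa>\<bar>"
  define c3 where "c3 = 2 * p * q * site_const"
  define C2 where "C2 = 1 / q * lam powr (- 5)"
  have pos: "0 < K" "0 \<le> d" "0 < c3" "0 < C2"
    using \<kappa> p_pos q_pos site_const_pos lam_pos by (auto simp: K_def d_def c3_def C2_def)
  \<comment> \<open>Success probability of a block, made uniform over the pairs by replacing l with
    its largest possible value (ln n + d) K.\<close>
  define low where "low n = c3 * (exp (- ((1 - \<epsilon>) * ln (real n)) - 2) / ((ln (real n) + d) * K + 1)^2) - C2 / real n ^ 2" for n
  have l_le: "real l \<le> (ln (real n) + d) * K"
    if "k \<le> l" "gfun p q (real k) (real l) \<le> (1 - \<epsilon>) * ln (real n)" "1 \<le> n" for k l n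
  proof -
    have "real l \<le> ((1 - \<epsilon>) * ln (real n) + 2 * \<kappa> + 2 - 2 * ln \<kappa>) / (2 * \<kappa>)"
      unfolding \<kappa>_def by (rule length_le_of_gfun_le[OF that(1,2)])
    also have "\<dots> \<le> (ln (real n) + d) / (2 * \<kappa>)"
    proof (intro divide_right_mono)
      have "(1 - \<epsilon>) * ln (real n) \<le> 1 * ln (real n)"
        using \<epsilon> that(3) by (intro mult_right_mono) auto
      then show "(1 - \<epsilon>) * ln (real n) + 2 * \<kappa> + 2 - 2 * ln \<kappa> \<le> ln (real n) + d"
        unfolding d_def by linarith
    qed (use \<kappa> in simp)
    finally show ?thesis by (simp add: K_def)
  qed
  \<comment> \<open>The cut at l = n makes the union finite; for large n it excludes no pair of the
    domain, where l is only of order ln n.\<close>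
  define F where "F n = (\<Union>(l, k)\<in>{(l, k). l \<le> n \<and> k \<le> l \<and> gfun p q (real k) (real l) \<le> (1 - \<epsilon>) * ln (real n)}.
     {\<omega> \<in> space M. \<forall>i<n div block_len n. \<not> block_ok n k l (inc (i * block_len n) (block_len n) \<omega>)})" for n
  have meas: "{\<omega> \<in> space M. \<forall>i<m. \<not> P (inc (i * B) B \<omega>)} \<in> sets M" for m P B
  proof -
    have "{\<omega> \<in> space M. \<forall>i<m. \<not> P (inc (i * B) B \<omega>)} = space M - (\<Union>i<m. {\<omega> \<in> space M. P (inc (i * B) B \<omega>)})"
      by auto
    also have "\<dots> \<in> sets M" using inc_event by auto
    finally show ?thesis .
  qed
  have fin: "finite {(l, k). l \<le> n \<and> k \<le> l \<and> gfun p q (real k) (real l) \<le> (1 - \<epsilon>) * ln (real n)}" (is "finite (?I n)") for n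
    by (rule finite_subset[of _ "{..n} \<times> {..n}"]) auto
  have bd: "prob (F n) \<le> (real n + 1)^2 * exp (- (5 * ln (real n)))"
    if n: "1 \<le> n" and low: "5 * ln (real n) \<le> (real n / (\<eta> * ln (real n) + 2) - 1) * low n"
      and low0: "0 \<le> low n" for n
  proof -
    let ?m = "n div block_len n"
    have "real n / (\<eta> * ln (real n) + 2) - 1 \<le> real n / real (block_len n) - 1"
      using block_len_bounds[OF n] block_len_pos[of n] \<eta>_pos n by (intro diff_mono divide_left_mono) (auto intro!: mult_pos_pos add_nonneg_pos)
    also have "\<dots> \<le> real ?m"
      using floor_divide_of_nat_eq[where ?'a = real, of n "block_len n"] by linarith
    finally have m: "real n / (\<eta> * ln (real n) + 2) - 1 \<le> real ?m" .
    have "prob (F n) \<le> (\<Sum>y\<in>?I n. prob (case y of (l, k) \<Rightarrow>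
        {\<omega> \<in> space M. \<forall>i<?m. \<not> block_ok n k l (inc (i * block_len n) (block_len n) \<omega>)}))"
      unfolding F_def using fin meas by (intro finite_measure_subadditive_finite) auto
    also have "\<dots> \<le> (\<Sum>y\<in>?I n. exp (- (5 * ln (real n))))"
    proof (rule sum_mono)
      fix y assume "y \<in> ?I n"
      then obtain l k where y: "y = (l, k)" and lk: "k \<le> l" "gfun p q (real k) (real l) \<le> (1 - \<epsilon>) * ln (real n)"
        by auto
      let ?h = "avg (block_len n) (\<lambda>xs. of_bool (block_ok n k l xs))"
      have "low n \<le> c3 * (exp (- ((1 - \<epsilon>) * ln (real n)) - 2) / (real l + 1)^2) - C2 / real n ^ 2"
        unfolding low_def using l_le[OF lk n] pos n by (intro diff_mono mult_left_mono divide_left_mono power_mono) auto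
      also have "\<dots> \<le> ?h"
        using prob_block_ok_ge[OF n lk] by (simp add: c3_def C2_def)
      finally have h: "low n \<le> ?h" .
      have "5 * ln (real n) \<le> (real n / (\<eta> * ln (real n) + 2) - 1) * low n" by (rule low)
      also have "\<dots> \<le> real ?m * ?h"
        using m h low0 by (intro mult_mono) auto
      finally have *: "exp (- (real ?m * ?h)) \<le> exp (- (5 * ln (real n)))" by simp
      show "prob (case y of (l, k) \<Rightarrow>
        {\<omega> \<in> space M. \<forall>i<?m. \<not> block_ok n k l (inc (i * block_len n) (block_len n) \<omega>)}) \<le> exp (- (5 * ln (real n)))"
        unfolding y prod.case by (rule order_trans[OF prob_no_block_le *])
    qed
    also have "\<dots> = real (card (?I n)) * exp (- (5 * ln (real n)))" by simp
    also have "\<dots> \<le> (real n + 1)^2 * exp (- (5 * ln (real n)))"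
    proof (rule mult_right_mono)
      have "card (?I n) \<le> card ({..n} \<times> {..n})" by (rule card_mono) auto
      then have "real (card (?I n)) \<le> real ((n + 1) * (n + 1))"
        unfolding of_nat_le_iff by (simp add: card_cartesian_product)
      then show "real (card (?I n)) \<le> (real n + 1)^2" by (simp add: power2_eq_square algebra_simps)
    qed simp
    finally show ?thesis .
  qed
  have ev: "eventually (\<lambda>n. 5 * ln (real n) \<le> (real n / (\<eta> * ln (real n) + 2) - 1) * low n) sequentially"
    unfolding low_def using pos \<eta>_pos \<epsilon> by real_asymp
  have ev0: "eventually (\<lambda>n. 0 \<le> low n) sequentially"
    unfolding low_def using pos \<epsilon> by real_asymp
  have ev_l: "eventually (\<lambda>n. (ln (real n) + d) * K \<le> real n) sequentially"
    using pos by real_asymp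
  have "AE \<omega> in M. eventually (\<lambda>n. \<omega> \<in> space M - F n) sequentially"
  proof (rule borel_cantelli_AE1)
    have "eventually (\<lambda>n. (real n + 1)^2 * exp (- (5 * ln (real n))) \<le> 1 / real n ^ 2) sequentially"
      by real_asymp
    then have "eventually (\<lambda>n. norm (prob (F n)) \<le> 1 / real n ^ 2) sequentially"
      using ev ev0 eventually_ge_at_top[of 1]
    proof eventually_elim
      case (elim n)
      then show ?case using bd[of n] by simp
    qed
    moreover have "summable (\<lambda>n. 1 / real n ^ 2)"
      using inverse_power_summable[of 2] by (simp add: field_simps)
    ultimately show "summable (\<lambda>n. prob (F n))"
      by (rule summable_comparison_test_ev)
    show "F n \<in> sets M" for n
      unfolding F_def using fin meas by (intro sets.finite_UN) auto
  qed (auto simp: less_top[symmetric])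
  then show ?thesis
  proof eventually_elim
    case (elim \<omega>)
    from ev_l elim eventually_ge_at_top[of 1]
    have "eventually (\<lambda>n. \<forall>k l. k \<le> l \<longrightarrow> gfun p q (real k) (real l) \<le> (1 - \<epsilon>) * ln (real n) \<longrightarrow>
     (\<exists>i<n div block_len n. block_ok n k l (inc (i * block_len n) (block_len n) \<omega>))) sequentially"
    proof eventually_elim
      case (elim n)
      show ?case
      proof (intro allI impI)
        fix k l assume kl: "k \<le> l" "gfun p q (real k) (real l) \<le> (1 - \<epsilon>) * ln (real n)"
        have "real l \<le> real n" using l_le[OF kl elim(3)] elim by linarith
        then have "(l, k) \<in> ?I n" using kl by auto
        then show "\<exists>i<n div block_len n. block_ok n k l (inc (i * block_len n) (block_len n) \<omega>)"
          using elim(2) unfolding F_def by blast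
      qed
    qed
    then show ?case by (simp add: eventually_sequentially)
  qed
qed

lemma lower_part:
  assumes \<epsilon>: "0 < \<epsilon>" "\<epsilon> < 1"
  shows "AE \<omega> in M. \<exists>n0::nat. \<forall>n\<ge>n0. \<forall>k l :: int.
        (real_of_int k, real_of_int l) \<in> scaleD ((1 - \<epsilon>) * ln (real n)) (Dset p q) \<longrightarrow>
        (\<exists>j\<le>n. int (loc_time X (walk X j \<omega>) \<omega>) = k + 1 \<and>
                int (nb_loc_time X (walk X j \<omega>) \<omega>) = l + 2)"
  using AE_steps AE_drift AE_block_ok[OF \<epsilon>]
proof eventually_elim
  case (elim \<omega>)
  from elim(2) obtain t0 where t0: "\<And>t s. t0 \<le> t \<Longrightarrow> s \<le> t \<Longrightarrow> \<beta> * (real t - real s) - \<alpha> * ln (real t) \<le> S t \<omega> - S s \<omega>"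
    by blast
  from elim(3) obtain n1 where n1: "\<forall>n\<ge>n1. \<forall>k l. k \<le> l \<longrightarrow> gfun p q (real k) (real l) \<le> (1 - \<epsilon>) * ln (real n) \<longrightarrow>
     (\<exists>i<n div block_len n. block_ok n k l (inc (i * block_len n) (block_len n) \<omega>))"
    by (rule exE)
  have "eventually (\<lambda>n. 2 * real t0 \<le> \<alpha> * ln (real n)) sequentially"
    "eventually (\<lambda>n. 5 < \<alpha> * ln (real n)) sequentially"
    "eventually (\<lambda>n. real t0 \<le> \<eta> * ln (real n)) sequentially"
    "eventually (\<lambda>n. \<alpha> / real n \<le> \<beta> / 2) sequentially"
    using \<alpha>_pos \<beta>_pos \<eta>_pos by real_asymp+
  then have "eventually (\<lambda>n. \<forall>k l :: int.
        (real_of_int k, real_of_int l) \<in> scaleD ((1 - \<epsilon>) * ln (real n)) (Dset p q) \<longrightarrow>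
        (\<exists>j\<le>n. int (loc_time X (S j \<omega>) \<omega>) = k + 1 \<and>
                int (nb_loc_time X (S j \<omega>) \<omega>) = l + 2)) sequentially"
    using eventually_ge_at_top[of "max n1 2"]
  proof eventually_elim
    case (elim n)
    have n: "1 \<le> n" "n1 \<le> n" "0 < ln (real n)" using elim(5) by auto
    show ?case
    proof (intro allI impI)
      fix k' l' :: int
      assume "(real_of_int k', real_of_int l') \<in> scaleD ((1 - \<epsilon>) * ln (real n)) (Dset p q)"
      then have D: "0 \<le> k'" "k' \<le> l'" "gfun p q (real_of_int k') (real_of_int l') \<le> (1 - \<epsilon>) * ln (real n)"
        using n \<epsilon> by (simp_all add: mem_scaleD_iff)
      define k l where "k = nat k'" and "l = nat l'"
      have kl: "k' = int k" "l' = int l" using D by (auto simp: k_def l_def)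
      let ?B = "block_len n" and ?L = "site_off n"
      obtain i where i: "i < n div ?B" and ok: "block_ok n k l (inc (i * ?B) ?B \<omega>)"
        using n1[rule_format, OF n(2), of k l] D unfolding kl by auto
      define t where "t = i * ?B"
      define z where "z = S t \<omega> + int ?L"
      have "t + ?B = Suc i * ?B" by (simp add: t_def)
      also have "\<dots> \<le> n div ?B * ?B" using i by (intro mult_right_mono) auto
      also have "\<dots> \<le> n" by simp
      finally have tB: "t + ?B \<le> n" .
      note L = site_off_bounds[OF n(1)] and B = block_len_bounds[OF n(1)]
      have past: "S s \<omega> < z - 1" if "s \<le> t" for s
      proof -
        have "real_of_int (S s \<omega>) \<le> S t \<omega> + \<alpha> * ln (real n)"
        proof (cases "t0 \<le> t \<and> 1 \<le> t")
          case True
          have "\<alpha> * ln (real t) \<le> \<alpha> * ln (real n)" using True tB \<alpha>_pos by simp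
          moreover have "0 \<le> \<beta> * (real t - real s)" using \<beta>_pos that by simp
          ultimately show ?thesis using t0[of t s] True that by simp
        next
          \<comment> \<open>Before \<open>t0\<close> the drift estimate is silent, but both
            positions are then bounded by \<open>t0\<close>, a constant that \<open>\<alpha>\<close>
            ln n outgrows.\<close>
          case False
          then have "\<bar>S s \<omega>\<bar> \<le> int t0" "\<bar>S t \<omega>\<bar> \<le> int t0"
            using abs_walk_le[OF \<open>\<forall>i\<ge>1. X i \<omega> \<in> {1, -1}\<close>, of s]
              abs_walk_le[OF \<open>\<forall>i\<ge>1. X i \<omega> \<in> {1, -1}\<close>, of t] that by linarith+
          then show ?thesis using elim(1) by linarith
        qed
        then show ?thesis using L unfolding z_def by linarith
      qed
      have future: "z + 1 < S s \<omega>" if "t + ?B < s" for s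
      proof -
        \<comment> \<open>The time s is unbounded, so ln s cannot be replaced by ln n. It is at most
          ln n + u/n, and the part u/n is absorbed by half of the drift; the other half is at least
          3 \<open>\<alpha>\<close> ln n.\<close>
        define u where "u = real s - real t"
        have u: "\<eta> * ln (real n) \<le> u" "0 < u" using that B n(1) by (auto simp: u_def)
        have "t0 \<le> s" using that B elim(3) by linarith
        then have 1: "\<beta> * u - \<alpha> * ln (real s) \<le> S s \<omega> - S t \<omega>"
          using t0[of s t] that by (simp add: u_def)
        have "real s \<le> real n + u" using tB by (simp add: u_def)
        also have "\<dots> = real n * (1 + u / real n)" using n by (simp add: field_simps)
        finally have "ln (real s) \<le> ln (real n * (1 + u / real n))"
          using that by (intro ln_mono) auto
        also have "\<dots> = ln (real n) + ln (1 + u / real n)"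
          using n u by (intro ln_mult_pos) (auto intro: add_pos_nonneg)
        also have "ln (1 + u / real n) \<le> u / real n"
          using u n by (intro ln_add_one_self_le_self) auto
        finally have "\<alpha> * ln (real s) \<le> \<alpha> * (ln (real n) + u / real n)"
          using \<alpha>_pos by simp
        also have "\<dots> = \<alpha> * ln (real n) + \<alpha> / real n * u" by (simp add: algebra_simps)
        also have "\<alpha> / real n * u \<le> \<beta> / 2 * u"
          using elim(4) u by (intro mult_right_mono) auto
        finally have 2: "\<alpha> * ln (real s) \<le> \<alpha> * ln (real n) + \<beta> * u / 2" by simp
        have "6 * \<alpha> * ln (real n) \<le> \<eta> * \<beta> * ln (real n)"
          using \<eta>_drift n by (intro mult_right_mono) auto
        also have "\<dots> \<le> \<beta> * u" using u(1) \<beta>_pos by (simp add: mult_ac)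
        finally have 3: "6 * (\<alpha> * ln (real n)) \<le> \<beta> * u" by simp
        show ?thesis using 1 2 3 elim(2) L unfolding z_def by linarith
      qed
      have "S s \<omega> \<notin> {z - 1, z, z + 1}" if "1 \<le> s" "s \<le> t \<or> t + ?B < s" for s
        using past[of s] future[of s] that by auto
      from local_times_window[OF this]
      have loc: "int (loc_time X z \<omega>) = visits {0} (S t \<omega> - z) (inc t ?B \<omega>)"
        "int (nb_loc_time X z \<omega>) = visits {-1, 1} (S t \<omega> - z) (inc t ?B \<omega>)" by blast+
      have "S t \<omega> - z = - int ?L" by (simp add: z_def)
      with loc ok have val: "int (loc_time X z \<omega>) = k' + 1" "int (nb_loc_time X z \<omega>) = l' + 2"
        by (simp_all add: block_ok_def kl t_def)
      \<comment> \<open>The count k' + 1 is positive, so the site is visited inside the block, and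
        any such visit time is a valid j.\<close>
      have "int (card {i. t < i \<and> i \<le> t + ?B \<and> S i \<omega> - z \<in> {0}}) = k' + 1"
        using val(1) loc(1) unfolding visits_inc by simp
      then have "{i. t < i \<and> i \<le> t + ?B \<and> S i \<omega> - z \<in> {0}} \<noteq> {}"
        using D(1) by (metis card.empty of_nat_0 add_nonneg_pos less_irrefl zero_less_one)
      then obtain j where "t < j" "j \<le> t + ?B" "S j \<omega> = z" by auto
      then show "\<exists>j\<le>n. int (loc_time X (S j \<omega>) \<omega>) = k' + 1 \<and> int (nb_loc_time X (S j \<omega>) \<omega>) = l' + 2"
        using val tB by (intro exI[of _ j]) auto
    qed
  qed
  then show ?case by (simp add: eventually_sequentially)
qed

end

theorem theorem3p4:
  fixes M :: "'a measure" and X :: "nat \<Rightarrow> 'a \<Rightarrow> int" and p q \<epsilon> :: real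
  assumes "prob_space M"
    and "0 < q" and "q < p" and "p < 1" and "p + q = 1"
    and "\<And>i. i \<ge> 1 \<Longrightarrow> X i \<in> measurable M (count_space UNIV)"
    and "prob_space.indep_vars M (\<lambda>_. count_space UNIV) X {1..}"
    and "\<And>i. i \<ge> 1 \<Longrightarrow> measure M {\<omega> \<in> space M. X i \<omega> = 1} = p"
    and "\<And>i. i \<ge> 1 \<Longrightarrow> measure M {\<omega> \<in> space M. X i \<omega> = -1} = q"
    and "0 < \<epsilon>" and "\<epsilon> < 1"
  shows "AE \<omega> in M. \<exists>n0::nat. \<forall>n\<ge>n0.
     (\<forall>j\<in>{1..n}.
        (real (loc_time X (walk X j \<omega>) \<omega>), real (nb_loc_time X (walk X j \<omega>) \<omega>))
          \<in> scaleD ((1 + \<epsilon>) * ln (real n)) (Dset p q)) \<and>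
     (\<forall>k l :: int.
        (real_of_int k, real_of_int l) \<in> scaleD ((1 - \<epsilon>) * ln (real n)) (Dset p q) \<longrightarrow>
        (\<exists>j\<le>n. int (loc_time X (walk X j \<omega>) \<omega>) = k + 1 \<and>
                int (nb_loc_time X (walk X j \<omega>) \<omega>) = l + 2))"
proof -
  interpret prob_space M by fact
  interpret drift_walk M p q X
    by unfold_locales (use assms in auto)
  show ?thesis
    using upper_part[OF \<open>0 < \<epsilon>\<close>] lower_part[OF \<open>0 < \<epsilon>\<close> \<open>\<epsilon> < 1\<close>]
  proof eventually_elim
    case (elim \<omega>)
    then obtain n1 n2 where n12: "\<forall>n\<ge>n1. \<forall>j\<in>{1..n}.
        (real (loc_time X (walk X j \<omega>) \<omega>), real (nb_loc_time X (walk X j \<omega>) \<omega>))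
          \<in> scaleD ((1 + \<epsilon>) * ln (real n)) (Dset p q)"
      "\<forall>n\<ge>n2. \<forall>k l :: int.
        (real_of_int k, real_of_int l) \<in> scaleD ((1 - \<epsilon>) * ln (real n)) (Dset p q) \<longrightarrow>
        (\<exists>j\<le>n. int (loc_time X (walk X j \<omega>) \<omega>) = k + 1 \<and>
                int (nb_loc_time X (walk X j \<omega>) \<omega>) = l + 2)"
      by blast
    show ?case
    proof (intro exI[of _ "max n1 n2"] allI impI)
      fix n assume "max n1 n2 \<le> n"
      then have "n1 \<le> n" "n2 \<le> n" by auto
      with n12 show "(\<forall>j\<in>{1..n}.
        (real (loc_time X (walk X j \<omega>) \<omega>), real (nb_loc_time X (walk X j \<omega>) \<omega>))
          \<in> scaleD ((1 + \<epsilon>) * ln (real n)) (Dset p q)) \<and>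
        (\<forall>k l :: int.
        (real_of_int k, real_of_int l) \<in> scaleD ((1 - \<epsilon>) * ln (real n)) (Dset p q) \<longrightarrow>
        (\<exists>j\<le>n. int (loc_time X (walk X j \<omega>) \<omega>) = k + 1 \<and>
                int (nb_loc_time X (walk X j \<omega>) \<omega>) = l + 2))"
        by blast
    qed
  qed
qed

end
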